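(* Let $n\in\mathbb{N}$, $t>0$, $0<r\le1$ and $1\le p<\infty$. Then the Hermite semigroup operator $e^{-tH}$ extends to an $r$-nuclear operator on $L^p(\mathbb{R}^n)$, with nuclear trace $$\mathrm{Tr}(e^{-tH})=\sum_{\nu\in\mathbb{N}_0^n}e^{-t(2|\nu|+n)}=(e^{t}-e^{-t})^{-n}.$$
   Context: $\mathbb{N}_0=\{0,1,2,\dots\}$ and $|\nu|=\nu_1+\dots+\nu_n$ for $\nu\in\mathbb{N}_0^n$. $H=-\Delta_x+|x|^2$ is the harmonic oscillator on $\mathbb{R}^n$, with eigenvalues $2|\nu|+n$ and eigenfunctions the Hermite functions $\phi_\nu(x)=\prod_{j=1}^n\phi_{\nu_j}(x_j)$, where $\phi_{\nu_j}(x_j)=(2^{\nu_j}\nu_j!\sqrt{\pi})^{-1/2}H_{\nu_j}(x_j)e^{-x_j^2/2}$ and $H_{\nu_j}$ is the Hermite polynomial of order $\nu_j$. The Hermite semigroup is $e^{-tH}f(x)=\sum_{\ell=0}^\infty e^{-t(2\ell+n)}P_\ell f(x)$, where $P_\ell f=\sum_{|\nu|=\ell}\widehat f(\phi_\nu)\phi_\nu$ and $\widehat f(\phi_\nu)=\int_{\mathbb{R}^n}f(x)\phi_\nu(x)\,dx$. For Banach spaces $E,F$ and $0<r\le1$, a linear operator $T:E\to F$ is $r$-nuclear if there exist sequences $(e_i')$ in the dual $E'$ and $(y_i)$ in $F$ with $Tf=\sum_i e_i'(f)y_i$ for all $f\in E$ and $\sum_i\Vert e_i'\Vert_{E'}^r\Vert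 y_i\Vert_F^r<\infty$. When $E=F$ has the approximation property (as $L^p$-spaces do), the nuclear trace of such a $T$ is $\mathrm{Tr}(T)=\sum_i e_i'(y_i)$, which does not depend on the chosen representation. *)

theory Defs
  imports "HOL-Analysis.Analysis"
begin

text \<open>
  A Banach space of classes of complex functions, such as \<open>L\<^sup>p\<close>, is represented by the set of
  representing functions and the seminorm on it. The Banach space meant is the quotient by the
  functions of seminorm 0: two functions whose difference has seminorm 0 are the same vector.
  Bounded linear functionals on the quotient are the same as seminorm-bounded linear functionals
  on the representatives.
\<close>

record 'a fun_space =
  carr :: "('a \<Rightarrow> complex) set"
  nrm :: "('a \<Rightarrow> complex) \<Rightarrow> real"

definition same_vector :: "'a fun_space \<Rightarrow> ('a \<Rightarrow> complex) \<Rightarrow> ('a \<Rightarrow> complex) \<Rightarrow> bool" where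
  "same_vector E f g \<longleftrightarrow> nrm E (\<lambda>x. f x - g x) = 0"

definition Lp :: "'a measure \<Rightarrow> real \<Rightarrow> 'a fun_space" where
  "Lp M p = \<lparr>
     carr = {f \<in> borel_measurable M. integrable M (\<lambda>x. norm (f x) powr p)},
     nrm = (\<lambda>f. (LINT x|M. norm (f x) powr p) powr (1 / p)) \<rparr>"

definition dual :: "'a fun_space \<Rightarrow> (('a \<Rightarrow> complex) \<Rightarrow> complex) set" where
  "dual E = {e.
     (\<forall>f\<in>carr E. \<forall>g\<in>carr E. e (\<lambda>x. f x + g x) = e f + e g) \<and>
     (\<forall>c. \<forall>f\<in>carr E. e (\<lambda>x. c * f x) = c * e f) \<and>
     (\<exists>C. \<forall>f\<in>carr E. norm (e f) \<le> C * nrm E f)}"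

definition dual_norm :: "'a fun_space \<Rightarrow> (('a \<Rightarrow> complex) \<Rightarrow> complex) \<Rightarrow> real" where
  "dual_norm E e = (SUP f \<in> {f \<in> carr E. nrm E f \<le> 1}. norm (e f))"

definition linear_operator ::
  "'a fun_space \<Rightarrow> 'b fun_space \<Rightarrow> (('a \<Rightarrow> complex) \<Rightarrow> ('b \<Rightarrow> complex)) \<Rightarrow> bool" where
  "linear_operator E F T \<longleftrightarrow>
     (\<forall>f\<in>carr E. T f \<in> carr F) \<and>
     (\<forall>f\<in>carr E. \<forall>g\<in>carr E. same_vector E f g \<longrightarrow> same_vector F (T f) (T g)) \<and>
     (\<forall>f\<in>carr E. \<forall>g\<in>carr E. same_vector F (T (\<lambda>x. f x + g x)) (\<lambda>x. T f x + T g x)) \<and>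
     (\<forall>c. \<forall>f\<in>carr E. same_vector F (T (\<lambda>x. c * f x)) (\<lambda>x. c * T f x))"

text \<open>The series \<open>\<Sum>i. e i f \<cdot> y i\<close> converges to \<open>T f\<close> in the norm of \<open>F\<close>.\<close>

definition nuclear_rep ::
  "real \<Rightarrow> 'a fun_space \<Rightarrow> 'b fun_space \<Rightarrow> (('a \<Rightarrow> complex) \<Rightarrow> ('b \<Rightarrow> complex)) \<Rightarrow>
   (nat \<Rightarrow> ('a \<Rightarrow> complex) \<Rightarrow> complex) \<Rightarrow> (nat \<Rightarrow> 'b \<Rightarrow> complex) \<Rightarrow> bool" where
  "nuclear_rep r E F T e y \<longleftrightarrow>
     (\<forall>i. e i \<in> dual E) \<and> (\<forall>i. y i \<in> carr F) \<and>
     (\<forall>f\<in>carr E. (\<lambda>N. nrm F (\<lambda>x. T f x - (\<Sum>i<N. e i f * y i x))) \<longlonglongrightarrow> 0) \<and>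
     summable (\<lambda>i. dual_norm E (e i) powr r * nrm F (y i) powr r)"

definition r_nuclear ::
  "real \<Rightarrow> 'a fun_space \<Rightarrow> 'b fun_space \<Rightarrow> (('a \<Rightarrow> complex) \<Rightarrow> ('b \<Rightarrow> complex)) \<Rightarrow> bool" where
  "r_nuclear r E F T \<longleftrightarrow> linear_operator E F T \<and> (\<exists>e y. nuclear_rep r E F T e y)"

text \<open>
  The definite description carries the independence of the trace from the representation (and
  from the exponent): the value is determined only if all representations give the same sum.
\<close>

definition nuclear_trace ::
  "'a fun_space \<Rightarrow> (('a \<Rightarrow> complex) \<Rightarrow> ('a \<Rightarrow> complex)) \<Rightarrow> complex" where
  "nuclear_trace E T =
     (THE s. \<exists>r e y. 0 < r \<and> r \<le> 1 \<and> nuclear_rep r E E T e y \<and> (\<lambda>i. e i (y i)) sums s)"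

text \<open>Physicists' Hermite polynomials, by Rodrigues' formula.\<close>

definition hermite_poly :: "nat \<Rightarrow> real \<Rightarrow> real" where
  "hermite_poly k x = (-1) ^ k * exp (x\<^sup>2) * (deriv ^^ k) (\<lambda>u. exp (- u\<^sup>2)) x"

definition hermite_fun1 :: "nat \<Rightarrow> real \<Rightarrow> real" where
  "hermite_fun1 k x = (2 ^ k * fact k * sqrt pi) powr (- 1 / 2) * hermite_poly k x * exp (- x\<^sup>2 / 2)"

definition mi_abs :: "('n::finite \<Rightarrow> nat) \<Rightarrow> nat" where
  "mi_abs \<nu> = (\<Sum>j\<in>UNIV. \<nu> j)"

definition hermite_fun :: "('n::finite \<Rightarrow> nat) \<Rightarrow> real ^ 'n \<Rightarrow> real" where
  "hermite_fun \<nu> x = (\<Prod>j\<in>UNIV. hermite_fun1 (\<nu> j) (x $ j))"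

definition hermite_coeff :: "(real ^ 'n \<Rightarrow> complex) \<Rightarrow> ('n::finite \<Rightarrow> nat) \<Rightarrow> complex" where
  "hermite_coeff f \<nu> = (LINT x|lborel. f x * of_real (hermite_fun \<nu> x))"

definition hermite_proj :: "nat \<Rightarrow> (real ^ 'n::finite \<Rightarrow> complex) \<Rightarrow> real ^ 'n \<Rightarrow> complex" where
  "hermite_proj l f x =
     (\<Sum>\<nu> \<in> {\<nu>. mi_abs \<nu> = l}. hermite_coeff f \<nu> * of_real (hermite_fun \<nu> x))"

definition hermite_semigroup ::
  "real \<Rightarrow> (real ^ 'n::finite \<Rightarrow> complex) \<Rightarrow> real ^ 'n \<Rightarrow> complex" where
  "hermite_semigroup t f x =
     (\<Sum>l. of_real (exp (- t * (2 * real l + real CARD('n)))) * hermite_proj l f x)"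

end

theory Submission
  imports Defs "HOL-Probability.Probability" "HOL-Computational_Algebra.Polynomial" "HOL-Real_Asymp.Real_Asymp"
begin

text \<open>
  The nuclear representation is the Hermite expansion itself: one term
  \<open>e\<^bsup>-t(2|\<nu>|+n)\<^esup> \<langle>\<cdot>, \<phi>\<^sub>\<nu>\<rangle> \<phi>\<^sub>\<nu>\<close> for each multi-index. Since \<open>|\<phi>\<^sub>k(x)| (1 + x\<^sup>2)\<close> is bounded by a
  polynomial in \<open>k\<close>, the norms of \<open>\<phi>\<^sub>\<nu>\<close> in \<open>L\<^sup>p\<close> and as a functional on \<open>L\<^sup>p\<close> grow polynomially in \<open>\<nu>\<close>, and
  the exponential weights make every \<open>r\<close>-th power sum finite. The trace is then
  the sum of the eigenvalues because \<open>\<phi>\<^sub>\<nu>\<close> has \<open>L\<^sup>2\<close>-norm 1; neither orthogonality nor completeness is used.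

  That the trace does not depend on the representation rests on the metric approximation property:
  if \<open>P = \<Sum>\<^sub>j g\<^sub>j \<otimes> h\<^sub>j\<close> has finite rank, then \<open>\<Sum>\<^sub>i e\<^sub>i(P y\<^sub>i) = \<Sum>\<^sub>j g\<^sub>j(T h\<^sub>j)\<close> for every
  representation of \<open>T\<close>, and contractions \<open>P\<close> close to the identity on finitely many \<open>y\<^sub>i\<close> bring the left-hand side
  close to \<open>\<Sum>\<^sub>i e\<^sub>i(y\<^sub>i)\<close>. In \<open>L\<^sup>p\<close> such \<open>P\<close> are averages over the level sets of simple functions.
\<close>

subsection \<open>Independence of the nuclear trace from the representation\<close>

text \<open>The trace is a definite description over representations with all exponents, so
  representations with different exponents have to be compared; as \<open>0 < r \<le> 1\<close>,
  each reduces to absolute summability of the products of norms. A uniform bound on the finite-rank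
  operators makes the comparison work: it controls the tail of the trace series before the operator
  is chosen, so only finitely many vectors remain to be approximated and one operator can serve both
  representations.

  On the analytic side one majorant has to serve every \<open>p \<ge> 1\<close>. The product of the
  factors \<open>1 / (1 + (x $ j)\<^sup>2)\<close> is integrable and at most 1, so it dominates its
  own p-th power, and the bound \<open>a * w \<le> a powr p + w\<close> takes over the role of
  Hoelder's inequality. A crude power of \<open>k\<close> in the decay estimate is enough, because
  the exponential eigenvalues absorb any polynomial. The same majorant makes the expansion converge
  absolutely at every point for every function in \<open>Lp lborel p\<close>, so the extended
  operator is given by the formula \<open>hermite_semigroup t\<close> itself.\<close>

locale seminormed_fun_space =
  fixes E :: "'a fun_space"
  assumes carr_zero: "(\<lambda>_. 0) \<in> carr E"
    and carr_add: "f \<in> carr E \<Longrightarrow> g \<in> carr E \<Longrightarrow> (\<lambda>x. f x + g x) \<in> carr E"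
    and carr_scale: "f \<in> carr E \<Longrightarrow> (\<lambda>x. c * f x) \<in> carr E"
    and nrm_add: "f \<in> carr E \<Longrightarrow> g \<in> carr E \<Longrightarrow> nrm E (\<lambda>x. f x + g x) \<le> nrm E f + nrm E g"
    and nrm_scale: "f \<in> carr E \<Longrightarrow> nrm E (\<lambda>x. c * f x) = norm c * nrm E f"
begin

lemma carr_diff: "f \<in> carr E \<Longrightarrow> g \<in> carr E \<Longrightarrow> (\<lambda>x. f x - g x) \<in> carr E"
  using carr_add[OF _ carr_scale[of g "-1"], of f] by simp

lemma nrm_diff: "f \<in> carr E \<Longrightarrow> g \<in> carr E \<Longrightarrow> nrm E (\<lambda>x. f x - g x) \<le> nrm E f + nrm E g"
  using nrm_add[OF _ carr_scale[of g "-1"], of f] nrm_scale[of g "-1"] by simp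

lemma carr_sum:
  assumes "finite J" "\<And>j. j \<in> J \<Longrightarrow> h j \<in> carr E"
  shows "(\<lambda>x. \<Sum>j\<in>J. c j * h j x) \<in> carr E"
  using assms
proof (induction)
  case (insert i J)
  then show ?case
    using carr_add[OF carr_scale[of "h i" "c i"]] by simp
qed (simp add: carr_zero)

lemma nrm_zero: "nrm E (\<lambda>_. 0) = 0"
  using nrm_scale[OF carr_zero, of 0] by simp

lemma nrm_nonneg: "f \<in> carr E \<Longrightarrow> 0 \<le> nrm E f"
  using nrm_diff[of f f] by (simp add: nrm_zero)

lemma dual_add: "e \<in> dual E \<Longrightarrow> f \<in> carr E \<Longrightarrow> g \<in> carr E \<Longrightarrow> e (\<lambda>x. f x + g x) = e f + e g"
  by (simp add: dual_def)

lemma dual_scale: "e \<in> dual E \<Longrightarrow> f \<in> carr E \<Longrightarrow> e (\<lambda>x. c * f x) = c * e f"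
  by (simp add: dual_def)

lemma dual_zero: "e \<in> dual E \<Longrightarrow> e (\<lambda>_. 0) = 0"
  using dual_scale[OF _ carr_zero, of e 0] by simp

lemma dual_diff:
  assumes "e \<in> dual E" "f \<in> carr E" "g \<in> carr E"
  shows "e (\<lambda>x. f x - g x) = e f - e g"
  using dual_add[of e f "\<lambda>x. -1 * g x"] dual_scale[of e g "-1"] carr_scale[of g "-1"] assms by simp

lemma dual_sum:
  assumes "e \<in> dual E" "finite J" "\<And>j. j \<in> J \<Longrightarrow> h j \<in> carr E"
  shows "e (\<lambda>x. \<Sum>j\<in>J. c j * h j x) = (\<Sum>j\<in>J. c j * e (h j))"
  using assms(2,3)
proof (induction)
  case empty
  then show ?case using assms(1) by (simp add: dual_zero)
next
  case (insert i J)
  have "e (\<lambda>x. c i * h i x + (\<Sum>j\<in>J. c j * h j x)) = e (\<lambda>x. c i * h i x) + e (\<lambda>x. \<Sum>j\<in>J. c j * h j x)"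
    using insert assms(1) by (intro dual_add carr_scale carr_sum) auto
  moreover have "e (\<lambda>x. c i * h i x) = c i * e (h i)"
    using assms(1) insert.prems by (simp add: dual_scale)
  ultimately show ?case using insert by simp
qed

text \<open>The supremum in \<open>dual_norm\<close> is taken in the reals and is meaningful only
  for a bounded set; every use of \<open>dual_norm\<close> as an upper bound rests on this.\<close>

lemma dual_norm_bdd: "e \<in> dual E \<Longrightarrow> bdd_above ((\<lambda>f. norm (e f)) ` {f \<in> carr E. nrm E f \<le> 1})"
proof -
  assume "e \<in> dual E"
  then obtain C where C: "\<forall>f\<in>carr E. norm (e f) \<le> C * nrm E f"
    by (auto simp: dual_def)
  have "norm (e f) \<le> \<bar>C\<bar>" if "f \<in> carr E" "nrm E f \<le> 1" for f
  proof -
    have "C * nrm E f \<le> \<bar>C\<bar> * 1"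
      using that nrm_nonneg[OF that(1)] by (intro mult_mono) auto
    then show ?thesis using C that by fastforce
  qed
  then show ?thesis by (intro bdd_aboveI2[where M = "\<bar>C\<bar>"]) auto
qed

lemma dual_norm_le:
  assumes "\<And>f. f \<in> carr E \<Longrightarrow> nrm E f \<le> 1 \<Longrightarrow> norm (e f) \<le> B"
  shows "dual_norm E e \<le> B"
proof -
  have "(\<lambda>_. 0) \<in> {f \<in> carr E. nrm E f \<le> 1}"
    by (simp add: carr_zero nrm_zero)
  then show ?thesis
    unfolding dual_norm_def by (intro cSUP_least) (use assms in auto)
qed

lemma dual_norm_nonneg: "e \<in> dual E \<Longrightarrow> 0 \<le> dual_norm E e"
  unfolding dual_norm_def
  by (rule cSUP_upper2[OF dual_norm_bdd, of _ "\<lambda>_. 0"]) (auto simp: carr_zero nrm_zero)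

lemma dual_bound:
  assumes "e \<in> dual E" "f \<in> carr E"
  shows "norm (e f) \<le> dual_norm E e * nrm E f"
proof (cases "nrm E f = 0")
  case True
  \<comment> \<open>A null vector cannot be rescaled to norm 1; the constant from
    \<open>dual\<close> bounds \<open>norm (e f)\<close> by a multiple of 0.\<close>
  then show ?thesis using assms by (fastforce simp: dual_def)
next
  case False
  then have pos: "nrm E f > 0" using nrm_nonneg[OF assms(2)] by simp
  let ?g = "\<lambda>x. of_real (1 / nrm E f) * f x"
  have "nrm E ?g = 1"
    using pos by (subst nrm_scale) (auto simp: assms norm_divide)
  then have "norm (e ?g) \<le> dual_norm E e"
    unfolding dual_norm_def
    by (intro cSUP_upper dual_norm_bdd assms CollectI conjI carr_scale) simp
  moreover have "e ?g = of_real (1 / nrm E f) * e f"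
    using assms by (intro dual_scale)
  ultimately have "norm (e f) / nrm E f \<le> dual_norm E e"
    using pos by (simp add: norm_mult norm_divide)
  then show ?thesis using pos by (simp add: field_simps)
qed

end

section \<open>Finite-rank contractions and uniqueness of the trace\<close>

definition finite_rank_contraction ::
  "'a fun_space \<Rightarrow> nat \<Rightarrow> (nat \<Rightarrow> ('a \<Rightarrow> complex) \<Rightarrow> complex) \<Rightarrow> (nat \<Rightarrow> 'a \<Rightarrow> complex) \<Rightarrow> bool" where
  "finite_rank_contraction E m g h \<longleftrightarrow>
     (\<forall>j<m. g j \<in> dual E) \<and> (\<forall>j<m. h j \<in> carr E) \<and>
     (\<forall>f\<in>carr E. nrm E (\<lambda>x. \<Sum>j<m. g j f * h j x) \<le> nrm E f)"

text \<open>Approximation is asked on finite sets instead of compact ones: for contractions the two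
  are equivalent by an \<open>\<epsilon>\<close>-net, and finite sets are what the trace argument
  supplies.\<close>

definition metric_approximation_property :: "'a fun_space \<Rightarrow> bool" where
  "metric_approximation_property E \<longleftrightarrow>
     (\<forall>Y \<epsilon>. finite Y \<longrightarrow> Y \<subseteq> carr E \<longrightarrow> 0 < \<epsilon> \<longrightarrow>
       (\<exists>m g h. finite_rank_contraction E m g h \<and>
          (\<forall>y\<in>Y. nrm E (\<lambda>x. y x - (\<Sum>j<m. g j y * h j x)) \<le> \<epsilon>)))"

text \<open>The inclusion of l^r in l^1: the powers tend to 0, so eventually
  \<open>a i \<le> 1\<close>, and there \<open>a i \<le> a i powr r\<close>.\<close>

lemma summable_of_summable_powr:
  fixes a :: "nat \<Rightarrow> real"
  assumes "0 < r" "r \<le> 1" "\<And>i. 0 \<le> a i" "summable (\<lambda>i. a i powr r)"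
  shows "summable a"
proof (rule summable_comparison_test_ev[OF _ assms(4)])
  have "eventually (\<lambda>i. a i powr r < 1) sequentially"
    using summable_LIMSEQ_zero[OF assms(4)] by (rule order_tendstoD) simp
  then show "eventually (\<lambda>i. norm (a i) \<le> a i powr r) sequentially"
  proof eventually_elim
    case (elim i)
    then have "a i \<le> 1"
      using ge_one_powr_ge_zero[of "a i" r] assms(1) by linarith
    then have "a i powr 1 \<le> a i powr r"
      using assms(1-3) by (intro powr_mono')
    then show ?case using assms(3)[of i] by simp
  qed
qed

context seminormed_fun_space
begin

context
  fixes r :: real and T e y
  assumes r: "0 < r" "r \<le> 1"
    and rep: "nuclear_rep r E E T e y"
    and T: "\<forall>f\<in>carr E. T f \<in> carr E"
begin

lemma rep_dual: "e i \<in> dual E" and rep_carr: "y i \<in> carr E"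
  using rep by (auto simp: nuclear_rep_def)

lemma nuclear_rep_summable_norms: "summable (\<lambda>i. dual_norm E (e i) * nrm E (y i))"
proof (rule summable_of_summable_powr[OF r])
  show "0 \<le> dual_norm E (e i) * nrm E (y i)" for i
    by (simp add: dual_norm_nonneg nrm_nonneg rep_dual rep_carr)
  show "summable (\<lambda>i. (dual_norm E (e i) * nrm E (y i)) powr r)"
    using rep by (simp add: nuclear_rep_def powr_mult dual_norm_nonneg nrm_nonneg)
qed

text \<open>Continuity carries each \<open>g j\<close> through the series for
  \<open>T (h j)\<close>, and the finite sum over \<open>j\<close> commutes with the sum over
  \<open>i\<close>. The limit refers to \<open>T\<close> and no longer to \<open>e\<close> and
  \<open>y\<close>.\<close>

lemma nuclear_rep_compose_finite_rank:
  assumes "finite_rank_contraction E m g h"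
  shows "(\<lambda>i. e i (\<lambda>x. \<Sum>j<m. g j (y i) * h j x)) sums (\<Sum>j<m. g j (T (h j)))"
proof -
  have g: "g j \<in> dual E" and h: "h j \<in> carr E" if "j < m" for j
    using assms that by (auto simp: finite_rank_contraction_def)
  have "(\<lambda>i. e i (h j) * g j (y i)) sums g j (T (h j))" if j: "j < m" for j
    unfolding sums_def
  proof (rule Lim_transform2[OF tendsto_const])
    have eq: "g j (T (h j)) - (\<Sum>i<N. e i (h j) * g j (y i)) = g j (\<lambda>x. T (h j) x - (\<Sum>i<N. e i (h j) * y i x))" for N
    proof -
      have "g j (\<lambda>x. \<Sum>i<N. e i (h j) * y i x) = (\<Sum>i<N. e i (h j) * g j (y i))"
        by (rule dual_sum[OF g[OF j]]) (auto simp: rep_carr)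
      then show ?thesis
        by (subst dual_diff[OF g[OF j]]) (auto intro!: T[rule_format] h j carr_sum rep_carr)
    qed
    have lim: "(\<lambda>N. nrm E (\<lambda>x. T (h j) x - (\<Sum>i<N. e i (h j) * y i x))) \<longlonglongrightarrow> 0"
      using rep h[OF j] by (auto simp: nuclear_rep_def)
    show "(\<lambda>N. g j (T (h j)) - (\<Sum>i<N. e i (h j) * g j (y i))) \<longlonglongrightarrow> 0"
    proof (rule Lim_null_comparison[OF always_eventually])
      show "\<forall>N. norm (g j (T (h j)) - (\<Sum>i<N. e i (h j) * g j (y i))) \<le>
          dual_norm E (g j) * nrm E (\<lambda>x. T (h j) x - (\<Sum>i<N. e i (h j) * y i x))"
        unfolding eq by (intro allI dual_bound g j carr_diff T[rule_format] h carr_sum rep_carr) auto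
      show "(\<lambda>N. dual_norm E (g j) * nrm E (\<lambda>x. T (h j) x - (\<Sum>i<N. e i (h j) * y i x))) \<longlonglongrightarrow> 0"
        using tendsto_mult_right_zero[OF lim] .
    qed
  qed
  then have "(\<lambda>i. \<Sum>j<m. e i (h j) * g j (y i)) sums (\<Sum>j<m. g j (T (h j)))"
    by (intro sums_sum) auto
  moreover have "e i (\<lambda>x. \<Sum>j<m. g j (y i) * h j x) = (\<Sum>j<m. e i (h j) * g j (y i))" for i
    by (subst dual_sum[OF rep_dual]) (auto simp: h mult.commute)
  ultimately show ?thesis by simp
qed

text \<open>The order of quantifiers is the point: \<open>Y\<close> and \<open>\<delta>\<close> are
  fixed before the operator, so two representations can impose their conditions on one common
  operator.\<close>

lemma nuclear_rep_trace_approx: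
  assumes S: "(\<lambda>i. e i (y i)) sums S" and "0 < \<epsilon>"
  shows "\<exists>Y \<delta>. finite Y \<and> Y \<subseteq> carr E \<and> 0 < \<delta> \<and>
    (\<forall>m g h. finite_rank_contraction E m g h \<longrightarrow>
       (\<forall>v\<in>Y. nrm E (\<lambda>x. v x - (\<Sum>j<m. g j v * h j x)) \<le> \<delta>) \<longrightarrow>
       norm (S - (\<Sum>j<m. g j (T (h j)))) \<le> \<epsilon>)"
proof -
  define b where "b i = dual_norm E (e i) * nrm E (y i)" for i
  have b: "summable b" "0 \<le> b i" for i
    using nuclear_rep_summable_norms
    by (auto simp: b_def[abs_def] dual_norm_nonneg nrm_nonneg rep_dual rep_carr)
  \<comment> \<open>A contraction gives \<open>norm (d i) \<le> 2 * b i\<close> below, so a tail of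
    \<open>b\<close> under \<open>\<epsilon> / 4\<close> contributes at most
    \<open>\<epsilon> / 2\<close>.\<close>
  obtain N where N: "norm (\<Sum>i. b (i + N)) < \<epsilon> / 4"
    using suminf_exist_split[OF _ b(1), of "\<epsilon> / 4"] \<open>0 < \<epsilon>\<close> by auto
  define D where "D = (\<Sum>i<N. dual_norm E (e i))"
  have D: "0 \<le> D"
    unfolding D_def by (intro sum_nonneg dual_norm_nonneg rep_dual)
  \<comment> \<open>The first \<open>N\<close> terms contribute at most \<open>D * \<delta>\<close>;
    \<open>D + 1\<close> keeps the denominator positive when \<open>D = 0\<close>.\<close>
  define \<delta> where "\<delta> = \<epsilon> / (2 * (D + 1))"
  have \<delta>: "0 < \<delta>" "D * \<delta> \<le> \<epsilon> / 2"
    using D \<open>0 < \<epsilon>\<close> by (auto simp: \<delta>_def field_simps)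
  show ?thesis
  proof (intro exI[of _ "y ` {..<N}"] exI[of _ \<delta>] conjI allI impI)
    fix m g h
    assume P: "finite_rank_contraction E m g h"
      and approx: "\<forall>v\<in>y ` {..<N}. nrm E (\<lambda>x. v x - (\<Sum>j<m. g j v * h j x)) \<le> \<delta>"
    define P where "P f = (\<lambda>x. \<Sum>j<m. g j f * h j x)" for f
    have Pc: "P f \<in> carr E" "nrm E (P f) \<le> nrm E f" if "f \<in> carr E" for f
      using P that by (auto simp: P_def finite_rank_contraction_def intro!: carr_sum)
    define d where "d i = e i (y i) - e i (P (y i))" for i
    have d: "d sums (S - (\<Sum>j<m. g j (T (h j))))"
      unfolding d_def using sums_diff[OF S nuclear_rep_compose_finite_rank[OF P]] by (simp add: P_def)
    have dn: "norm (d i) \<le> dual_norm E (e i) * nrm E (\<lambda>x. y i x - P (y i) x)" for i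
      unfolding d_def
      by (subst dual_diff[OF rep_dual, symmetric])
        (auto intro!: dual_bound Pc rep_carr rep_dual carr_diff)
    have d2: "norm (d i) \<le> 2 * b i" for i
    proof -
      have "nrm E (\<lambda>x. y i x - P (y i) x) \<le> 2 * nrm E (y i)"
        using nrm_diff[of "y i" "P (y i)"] Pc[of "y i"] by (simp add: rep_carr)
      then have "dual_norm E (e i) * nrm E (\<lambda>x. y i x - P (y i) x) \<le> dual_norm E (e i) * (2 * nrm E (y i))"
        by (intro mult_left_mono dual_norm_nonneg rep_dual)
      then show ?thesis using dn[of i] by (simp add: b_def mult_ac)
    qed
    have "(S - (\<Sum>j<m. g j (T (h j)))) = (\<Sum>i. d (i + N)) + (\<Sum>i<N. d i)"
      using suminf_split_initial_segment[of d N] d by (auto simp: sums_iff)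
    also have "norm \<dots> \<le> norm (\<Sum>i. d (i + N)) + norm (\<Sum>i<N. d i)"
      by (rule norm_triangle_ineq)
    also have "norm (\<Sum>i<N. d i) \<le> \<epsilon> / 2"
    proof -
      have "norm (\<Sum>i<N. d i) \<le> (\<Sum>i<N. dual_norm E (e i) * \<delta>)"
      proof (rule sum_norm_le)
        fix i assume "i \<in> {..<N}"
        then have "nrm E (\<lambda>x. y i x - P (y i) x) \<le> \<delta>"
          using approx by (auto simp: P_def)
        then show "norm (d i) \<le> dual_norm E (e i) * \<delta>"
          using dn[of i] by (elim order_trans[OF _ mult_left_mono]) (auto intro: dual_norm_nonneg rep_dual)
      qed
      also have "\<dots> = D * \<delta>"
        by (simp add: D_def sum_distrib_right)
      finally show ?thesis using \<delta> by simp
    qed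
    also have "norm (\<Sum>i. d (i + N)) \<le> \<epsilon> / 2"
    proof -
      have s: "summable (\<lambda>i. 2 * b (i + N))"
        using b(1) by (intro summable_mult) (simp add: summable_iff_shift)
      have "norm (\<Sum>i. d (i + N)) \<le> (\<Sum>i. 2 * b (i + N))"
        by (rule norm_suminf_le[OF d2 s])
      also have "\<dots> = 2 * (\<Sum>i. b (i + N))"
        using b(1) by (intro suminf_mult) (simp add: summable_iff_shift)
      finally show ?thesis using N by simp
    qed
    finally show "norm (S - (\<Sum>j<m. g j (T (h j)))) \<le> \<epsilon>" by simp
  qed (auto simp: \<delta> rep_carr)
qed

end

text \<open>A contraction adapted to the finite sets of both representations puts \<open>S1\<close>
  and \<open>S2\<close> within \<open>\<epsilon> / 2\<close> of the same number. The exponents may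
  differ because \<open>nuclear_trace\<close> quantifies over them as well.\<close>

lemma nuclear_rep_trace_unique:
  assumes map: "metric_approximation_property E"
    and T: "\<forall>f\<in>carr E. T f \<in> carr E"
    and rep1: "0 < r1" "r1 \<le> 1" "nuclear_rep r1 E E T e1 y1" "(\<lambda>i. e1 i (y1 i)) sums S1"
    and rep2: "0 < r2" "r2 \<le> 1" "nuclear_rep r2 E E T e2 y2" "(\<lambda>i. e2 i (y2 i)) sums S2"
  shows "S1 = S2"
proof -
  have "dist S1 S2 \<le> \<epsilon>" if "\<epsilon> > 0" for \<epsilon>
  proof -
    have "0 < \<epsilon> / 2" using that by simp
    from nuclear_rep_trace_approx[where e = e1 and y = y1, OF rep1(1-3) T rep1(4) \<open>0 < \<epsilon> / 2\<close>]
    obtain Y1 \<delta>1 where 1: "finite Y1" "Y1 \<subseteq> carr E" "0 < \<delta>1"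
      "\<forall>m g h. finite_rank_contraction E m g h \<longrightarrow>
        (\<forall>v\<in>Y1. nrm E (\<lambda>x. v x - (\<Sum>j<m. g j v * h j x)) \<le> \<delta>1) \<longrightarrow>
        norm (S1 - (\<Sum>j<m. g j (T (h j)))) \<le> \<epsilon> / 2"
      by (elim exE conjE)
    from nuclear_rep_trace_approx[where e = e2 and y = y2, OF rep2(1-3) T rep2(4) \<open>0 < \<epsilon> / 2\<close>]
    obtain Y2 \<delta>2 where 2: "finite Y2" "Y2 \<subseteq> carr E" "0 < \<delta>2"
      "\<forall>m g h. finite_rank_contraction E m g h \<longrightarrow>
        (\<forall>v\<in>Y2. nrm E (\<lambda>x. v x - (\<Sum>j<m. g j v * h j x)) \<le> \<delta>2) \<longrightarrow>
        norm (S2 - (\<Sum>j<m. g j (T (h j)))) \<le> \<epsilon> / 2"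
      by (elim exE conjE)
    have Y: "finite (Y1 \<union> Y2)" "Y1 \<union> Y2 \<subseteq> carr E" "0 < min \<delta>1 \<delta>2"
      using 1(1-3) 2(1-3) by auto
    from map[unfolded metric_approximation_property_def, THEN spec[of _ "Y1 \<union> Y2"],
        THEN spec[of _ "min \<delta>1 \<delta>2"], THEN mp, OF Y(1), THEN mp, OF Y(2), THEN mp, OF Y(3)]
    obtain m g h where P: "finite_rank_contraction E m g h"
      "\<forall>v\<in>Y1 \<union> Y2. nrm E (\<lambda>x. v x - (\<Sum>j<m. g j v * h j x)) \<le> min \<delta>1 \<delta>2"
      by (elim exE conjE)
    have "norm (S1 - (\<Sum>j<m. g j (T (h j)))) \<le> \<epsilon> / 2"
    proof (rule 1(4)[THEN spec, THEN spec, THEN spec, THEN mp, OF P(1), THEN mp], rule ballI)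
      fix v assume "v \<in> Y1"
      then have "v \<in> Y1 \<union> Y2" by simp
      from bspec[OF P(2) this] show "nrm E (\<lambda>x. v x - (\<Sum>j<m. g j v * h j x)) \<le> \<delta>1"
        by simp
    qed
    moreover have "norm (S2 - (\<Sum>j<m. g j (T (h j)))) \<le> \<epsilon> / 2"
    proof (rule 2(4)[THEN spec, THEN spec, THEN spec, THEN mp, OF P(1), THEN mp], rule ballI)
      fix v assume "v \<in> Y2"
      then have "v \<in> Y1 \<union> Y2" by simp
      from bspec[OF P(2) this] show "nrm E (\<lambda>x. v x - (\<Sum>j<m. g j v * h j x)) \<le> \<delta>2"
        by simp
    qed
    ultimately show ?thesis
      using dist_triangle2[of S1 S2 "\<Sum>j<m. g j (T (h j))"] unfolding dist_norm by linarith
  qed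
  then have "dist S1 S2 \<le> 0"
    using field_le_epsilon[of "dist S1 S2" 0] by simp
  then show ?thesis by simp
qed

lemma nuclear_trace_eqI:
  assumes "metric_approximation_property E" "linear_operator E E T"
    and "0 < r" "r \<le> 1" "nuclear_rep r E E T e y" "(\<lambda>i. e i (y i)) sums S"
  shows "nuclear_trace E T = S"
  unfolding nuclear_trace_def
proof (rule the_equality)
  show "\<exists>r e y. 0 < r \<and> r \<le> 1 \<and> nuclear_rep r E E T e y \<and> (\<lambda>i. e i (y i)) sums S"
    by (rule exI[of _ r], rule exI[of _ e], rule exI[of _ y]) (simp add: assms)
  have T: "\<forall>f\<in>carr E. T f \<in> carr E"
    using assms(2) by (simp add: linear_operator_def)
  show "s = S" if "\<exists>r e y. 0 < r \<and> r \<le> 1 \<and> nuclear_rep r E E T e y \<and> (\<lambda>i. e i (y i)) sums s" for s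
  proof -
    from that obtain r' e' y' where *: "0 < r'" "r' \<le> 1" "nuclear_rep r' E E T e' y'" "(\<lambda>i. e' i (y' i)) sums s"
      by (elim exE conjE)
    show ?thesis
      by (rule nuclear_rep_trace_unique[where ?e1.0 = e' and ?y1.0 = y' and ?e2.0 = e and ?y2.0 = y, OF assms(1) T * assms(3-6)])
  qed
qed

end

subsection \<open>The spaces \<open>L\<^sup>p\<close>\<close>

lemma carr_Lp: "f \<in> carr (Lp M p) \<longleftrightarrow> f \<in> borel_measurable M \<and> integrable M (\<lambda>x. norm (f x) powr p)"
  and nrm_Lp: "nrm (Lp M p) f = (LINT x|M. norm (f x) powr p) powr (1 / p)"
  by (simp_all add: Lp_def)

lemma nrm_Lp_powr: "p > 0 \<Longrightarrow> nrm (Lp M p) f powr p = (LINT x|M. norm (f x) powr p)"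
  by (simp add: nrm_Lp powr_powr integral_nonneg_AE)

lemma nrm_Lp_nonneg: "0 \<le> nrm (Lp M p) f"
  by (simp add: nrm_Lp)

lemma nrm_Lp_le_iff:
  assumes "p > 0" "a \<ge> 0"
  shows "nrm (Lp M p) f \<le> a \<longleftrightarrow> (LINT x|M. norm (f x) powr p) \<le> a powr p"
  using assms powr_le_cancel_iff powr_mono2[of p "nrm (Lp M p) f" a] powr_less_mono2[of p a "nrm (Lp M p) f"]
  by (auto simp: nrm_Lp_powr[symmetric] nrm_Lp_nonneg not_le[symmetric])

text \<open>Young's inequality for \<open>u powr p\<close> and \<open>c powr p\<close> with weights
  \<open>1 / p\<close> and \<open>1 - 1 / p\<close>, multiplied by \<open>p\<close> and rearranged;
  at \<open>u = 0\<close> what remains is \<open>1 \<le> p\<close>. This one form of convexity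
  yields both Minkowski's and Jensen's inequality.\<close>

lemma powr_tangent:
  fixes u c p :: real
  assumes p: "1 \<le> p" and "0 \<le> u" "0 < c"
  shows "c powr p + p * c powr (p - 1) * (u - c) \<le> u powr p"
proof -
  have cc: "c powr (p - 1) * c = c powr p"
    using \<open>0 < c\<close> by (simp add: powr_diff)
  show ?thesis
  proof (cases "u = 0")
    case True
    have "c powr p * 1 \<le> c powr p * p"
      using p by (intro mult_left_mono) auto
    then show ?thesis
      unfolding True cc[symmetric] using p by (simp add: algebra_simps)
  next
    case False
    then have "u > 0" using \<open>0 \<le> u\<close> by simp
    have "(u powr p) powr (1 / p) * (c powr p) powr (1 - 1 / p) \<le> 1 / p * u powr p + (1 - 1 / p) * c powr p"
      using p \<open>u > 0\<close> \<open>0 < c\<close> by (intro Youngs_inequality_0) auto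
    moreover have "p * (1 - 1 / p) = p - 1" using p by (simp add: field_simps)
    ultimately have "u * c powr (p - 1) \<le> 1 / p * u powr p + (1 - 1 / p) * c powr p"
      using p \<open>u > 0\<close> by (simp add: powr_powr)
    from mult_left_mono[OF this, of p] p
    have "p * (u * c powr (p - 1)) \<le> p * (1 / p * u powr p + (1 - 1 / p) * c powr p)"
      by simp
    also have "\<dots> = u powr p + (p - 1) * c powr p"
      using p by (simp add: algebra_simps)
    finally show ?thesis
      using cc by (simp add: algebra_simps)
  qed
qed

text \<open>Two-point Jensen inequality at \<open>x / a\<close> and \<open>y / b\<close>, whose mean
  with weights \<open>a / (a + b)\<close> and \<open>b / (a + b)\<close> is
  \<open>(x + y) / (a + b)\<close>. The free \<open>a\<close> and \<open>b\<close> become bounds for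
  the two norms in Minkowski's inequality.\<close>

lemma powr_add_le:
  fixes x y a b p :: real
  assumes p: "1 \<le> p" and "0 \<le> x" "0 \<le> y" "0 < a" "0 < b"
  shows "(x + y) powr p \<le> (a + b) powr p * (a / (a + b) * (x powr p / a powr p) + b / (a + b) * (y powr p / b powr p))"
proof (cases "x + y = 0")
  case True
  then show ?thesis using assms by (simp add: powr_ge_zero)
next
  case False
  define s where "s = a + b"
  have s: "s > 0" using assms by (simp add: s_def)
  define c where "c = (x + y) / s"
  have "c > 0" using False assms s by (simp add: c_def)
  have ab: "a / s + b / s = 1" using s by (simp add: s_def add_divide_distrib[symmetric])
  have avg: "a / s * (x / a) + b / s * (y / b) = c"
    using assms by (simp add: c_def add_divide_distrib)
  \<comment> \<open>The added term is 0, since the weights sum to 1 and the mean is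
    \<open>c\<close>; it splits the constant into the values of the tangent at the two
    points.\<close>
  have "c powr p = (a / s + b / s) * c powr p + p * c powr (p - 1) * ((a / s * (x / a) + b / s * (y / b)) - (a / s + b / s) * c)"
    unfolding ab avg by simp
  also have "\<dots> = a / s * (c powr p + p * c powr (p - 1) * (x / a - c)) + b / s * (c powr p + p * c powr (p - 1) * (y / b - c))"
    by (simp add: algebra_simps)
  also have "\<dots> \<le> a / s * (x / a) powr p + b / s * (y / b) powr p"
    using assms s \<open>c > 0\<close> by (intro add_mono mult_left_mono powr_tangent) auto
  finally have le: "c powr p \<le> a / s * (x / a) powr p + b / s * (y / b) powr p" .
  have "(x + y) powr p = s powr p * c powr p"
    using s assms by (simp add: c_def powr_divide)
  also have "\<dots> \<le> s powr p * (a / s * (x / a) powr p + b / s * (y / b) powr p)"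
    using le by (rule mult_left_mono) simp
  finally show ?thesis
    using assms by (simp add: s_def powr_divide)
qed

lemma carr_Lp_add:
  assumes p: "1 \<le> p" and f: "f \<in> carr (Lp M p)" and g: "g \<in> carr (Lp M p)"
  shows "(\<lambda>x. f x + g x) \<in> carr (Lp M p)"
proof -
  have [measurable]: "f \<in> borel_measurable M" "g \<in> borel_measurable M"
    using f g by (auto simp: carr_Lp)
  \<comment> \<open>The right-hand side of \<open>powr_add_le\<close> at \<open>a = b = 1\<close>,
    left unsimplified so that the lemma matches.\<close>
  let ?b = "\<lambda>x. (1 + 1) powr p * (1 / (1 + 1) * (norm (f x) powr p / 1 powr p) + 1 / (1 + 1) * (norm (g x) powr p / 1 powr p))"
  have "integrable M (\<lambda>x. norm (f x + g x) powr p)"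
  proof (rule Bochner_Integration.integrable_bound[of _ ?b])
    show "integrable M ?b"
      using f g by (intro integrable_mult_right Bochner_Integration.integrable_add integrable_divide) (auto simp: carr_Lp)
    have "norm (norm (f x + g x) powr p) \<le> norm (?b x)" for x
    proof -
      have "norm (f x + g x) powr p \<le> (norm (f x) + norm (g x)) powr p"
        using p by (intro powr_mono2 norm_triangle_ineq) auto
      also have "\<dots> \<le> ?b x"
        using p by (intro powr_add_le) auto
      finally show ?thesis by simp
    qed
    then show "AE x in M. norm (norm (f x + g x) powr p) \<le> norm (?b x)" by simp
  qed measurable
  then show ?thesis by (simp add: carr_Lp)
qed

text \<open>Minkowski's inequality, from the convexity of \<open>u\<^sup>p\<close> with any \<open>a\<close>, \<open>b\<close> above the two norms.\<close>

lemma nrm_Lp_add: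
  assumes p: "1 \<le> p" and f: "f \<in> carr (Lp M p)" and g: "g \<in> carr (Lp M p)"
  shows "nrm (Lp M p) (\<lambda>x. f x + g x) \<le> nrm (Lp M p) f + nrm (Lp M p) g"
proof -
  have *: "nrm (Lp M p) (\<lambda>x. f x + g x) \<le> a + b"
    if a: "a > 0" "nrm (Lp M p) f \<le> a" and b: "b > 0" "nrm (Lp M p) g \<le> b" for a b
  proof -
    let ?b = "\<lambda>x. (a + b) powr p * (a / (a + b) * (norm (f x) powr p / a powr p) + b / (a + b) * (norm (g x) powr p / b powr p))"
    have If: "(LINT x|M. norm (f x) powr p) / a powr p \<le> 1" and Ig: "(LINT x|M. norm (g x) powr p) / b powr p \<le> 1"
      using a b p by (auto simp: nrm_Lp_le_iff)
    have "(LINT x|M. norm (f x + g x) powr p) \<le> (LINT x|M. ?b x)"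
    proof (rule integral_mono)
      show "integrable M (\<lambda>x. norm (f x + g x) powr p)"
        using carr_Lp_add[OF assms] by (simp add: carr_Lp)
      show "integrable M ?b"
        using f g by (intro integrable_mult_right Bochner_Integration.integrable_add integrable_divide) (auto simp: carr_Lp)
      show "norm (f x + g x) powr p \<le> ?b x" for x
      proof -
        have "norm (f x + g x) powr p \<le> (norm (f x) + norm (g x)) powr p"
          using p by (intro powr_mono2 norm_triangle_ineq) auto
        also have "\<dots> \<le> ?b x"
          using p a b by (intro powr_add_le) auto
        finally show ?thesis .
      qed
    qed
    also have "\<dots> = (a + b) powr p * (a / (a + b) * ((LINT x|M. norm (f x) powr p) / a powr p) + b / (a + b) * ((LINT x|M. norm (g x) powr p) / b powr p))"
      using f g by (simp add: carr_Lp)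
    also have "\<dots> \<le> (a + b) powr p * (a / (a + b) * 1 + b / (a + b) * 1)"
      using a b by (intro mult_left_mono add_mono If Ig) auto
    also have "a / (a + b) * 1 + b / (a + b) * 1 = 1"
      using a b by (simp add: add_divide_distrib[symmetric])
    finally show ?thesis
      using a b p by (simp add: nrm_Lp_le_iff)
  qed
  show ?thesis
  proof (rule field_le_epsilon)
    \<comment> \<open>Norms may be 0 while \<open>a\<close> and \<open>b\<close> must be positive,
      so each norm is enlarged by \<open>e / 2\<close>.\<close>
    fix e :: real assume "e > 0"
    then show "nrm (Lp M p) (\<lambda>x. f x + g x) \<le> nrm (Lp M p) f + nrm (Lp M p) g + e"
      using *[of "nrm (Lp M p) f + e / 2" "nrm (Lp M p) g + e / 2"] nrm_Lp_nonneg[of M p f] nrm_Lp_nonneg[of M p g]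
      by simp
  qed
qed

lemma seminormed_Lp:
  assumes p: "1 \<le> p"
  shows "seminormed_fun_space (Lp M p)"
proof
  fix f g :: "'a \<Rightarrow> complex" and c :: complex
  assume f: "f \<in> carr (Lp M p)"
  show "(\<lambda>x. c * f x) \<in> carr (Lp M p)"
    using f by (auto simp: carr_Lp norm_mult powr_mult)
  show "nrm (Lp M p) (\<lambda>x. c * f x) = norm c * nrm (Lp M p) f"
    using p by (simp add: nrm_Lp norm_mult powr_mult powr_powr integral_nonneg_AE)
  assume g: "g \<in> carr (Lp M p)"
  show "(\<lambda>x. f x + g x) \<in> carr (Lp M p)"
    by (rule carr_Lp_add[OF p f g])
  show "nrm (Lp M p) (\<lambda>x. f x + g x) \<le> nrm (Lp M p) f + nrm (Lp M p) g"
    by (rule nrm_Lp_add[OF p f g])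
qed (use p in \<open>simp add: carr_Lp\<close>)

subsection \<open>Averages over finite partitions\<close>

definition average :: "'a measure \<Rightarrow> 'a set \<Rightarrow> ('a \<Rightarrow> complex) \<Rightarrow> complex" where
  "average M A f = (LINT x|M. of_real (indicator A x) * f x) / of_real (measure M A)"

text \<open>Where \<open>norm (f x) \<le> 1\<close> the indicator dominates; elsewhere
  \<open>norm (f x) \<le> norm (f x) powr p\<close>. The sum of the two majorants is
  integrable.\<close>

lemma integrable_indicator_Lp:
  assumes p: "1 \<le> p" and f: "f \<in> carr (Lp M p)" and A: "A \<in> sets M" "emeasure M A < \<infinity>"
  shows "integrable M (\<lambda>x. of_real (indicator A x) * f x :: complex)"
proof (rule Bochner_Integration.integrable_bound)
  have [measurable]: "f \<in> borel_measurable M"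
    using f by (auto simp: carr_Lp)
  note A(1)[measurable]
  show "integrable M (\<lambda>x. indicator A x + norm (f x) powr p)"
    using f A by (auto simp: carr_Lp intro!: Bochner_Integration.integrable_add)
  show "(\<lambda>x. of_real (indicator A x) * f x :: complex) \<in> borel_measurable M"
    by measurable
  have "norm (of_real (indicator A x) * f x) \<le> norm (indicator A x + norm (f x) powr p)" for x
  proof (cases "norm (f x) \<le> 1")
    case True
    then show ?thesis by (auto simp: indicator_def norm_mult intro: order_trans[OF True])
  next
    case False
    then have "norm (f x) powr 1 \<le> norm (f x) powr p"
      using p by (intro powr_mono) auto
    then show ?thesis using False by (auto simp: indicator_def norm_mult)
  qed
  then show "AE x in M. norm (of_real (indicator A x) * f x) \<le> norm (indicator A x + norm (f x) powr p)"
    by simp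
qed

text \<open>Jensen's inequality on \<open>A\<close>, by integrating the tangent line of \<open>u\<^sup>p\<close> at the modulus of the average.\<close>

lemma average_powr_le:
  assumes p: "1 \<le> p" and f: "f \<in> carr (Lp M p)" and A: "A \<in> sets M" "emeasure M A < \<infinity>"
  shows "norm (average M A f) powr p * measure M A \<le> (LINT x|M. indicator A x * norm (f x) powr p)"
proof (cases "average M A f = 0")
  case True
  then show ?thesis using p by (simp add: integral_nonneg_AE)
next
  case False
  define c where "c = norm (average M A f)"
  have c: "c > 0" using False by (simp add: c_def)
  have m: "measure M A > 0"
    using False by (auto simp: average_def zero_less_measure_iff)
  have int: "integrable M (\<lambda>x. of_real (indicator A x) * f x :: complex)"
    by (rule integrable_indicator_Lp[OF assms])
  then have int_norm: "integrable M (\<lambda>x. indicator A x * norm (f x))"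
    using integrable_norm[OF int] by (simp add: norm_mult)
  have intA: "integrable M (indicator A :: 'a \<Rightarrow> real)"
    using A by simp
  have int_p: "integrable M (\<lambda>x. indicator A x * norm (f x) powr p)"
    using integrable_mult_indicator[OF A(1), of "\<lambda>x. norm (f x) powr p"] f by (simp add: carr_Lp)
  have "c * measure M A = norm (LINT x|M. of_real (indicator A x) * f x :: complex)"
    using m by (simp add: c_def average_def norm_divide)
  also have "\<dots> \<le> (LINT x|M. norm (of_real (indicator A x) * f x))"
    by (rule integral_norm_bound)
  also have "\<dots> = (LINT x|M. indicator A x * norm (f x))"
    by (simp add: norm_mult)
  finally have le: "0 \<le> p * c powr (p - 1) * ((LINT x|M. indicator A x * norm (f x)) - c * measure M A)"
    using p by simp
  let ?l = "\<lambda>x. c powr p * indicator A x + p * c powr (p - 1) * (indicator A x * norm (f x) - c * indicator A x)"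
  have "c powr p * measure M A \<le> c powr p * measure M A +
      p * c powr (p - 1) * ((LINT x|M. indicator A x * norm (f x)) - c * measure M A)"
    using le by simp
  also have "\<dots> = (LINT x|M. ?l x)"
    using int_norm intA A by simp
  also have "\<dots> \<le> (LINT x|M. indicator A x * norm (f x) powr p)"
  proof (rule integral_mono)
    show "integrable M ?l"
      using int_norm intA by simp
    show "?l x \<le> indicator A x * norm (f x) powr p" for x
      using powr_tangent[OF p _ c, of "norm (f x)"] by (auto simp: indicator_def)
  qed (rule int_p)
  finally show ?thesis by (simp add: c_def)
qed

text \<open>Jensen's inequality bounds the functional by
  \<open>(1 / measure M A) powr (1 / p)\<close>; on a set of measure 0 the functional is 0, because
  division by 0 gives 0.\<close>

lemma average_in_dual:
  assumes p: "1 \<le> p" and A: "A \<in> sets M" "emeasure M A < \<infinity>"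
  shows "average M A \<in> dual (Lp M p)"
proof -
  note int = integrable_indicator_Lp[OF p _ A]
  have "average M A (\<lambda>x. f x + g x) = average M A f + average M A g"
    if "f \<in> carr (Lp M p)" "g \<in> carr (Lp M p)" for f g
    using int[OF that(1)] int[OF that(2)]
    by (simp add: average_def distrib_left add_divide_distrib)
  moreover have "average M A (\<lambda>x. c * f x) = c * average M A f" if "f \<in> carr (Lp M p)" for f c
    by (simp add: average_def mult.left_commute)
  moreover have "norm (average M A f) \<le> (1 / measure M A) powr (1 / p) * nrm (Lp M p) f" if f: "f \<in> carr (Lp M p)" for f
  proof (cases "measure M A = 0")
    case True
    then show ?thesis by (simp add: average_def nrm_Lp_nonneg)
  next
    case False
    then have m: "measure M A > 0" by (simp add: zero_less_measure_iff)
    have "norm (average M A f) powr p * measure M A \<le> (LINT x|M. indicator A x * norm (f x) powr p)"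
      by (rule average_powr_le[OF p f A])
    also have "\<dots> \<le> (LINT x|M. norm (f x) powr p)"
      using f integrable_mult_indicator[OF A(1), of "\<lambda>x. norm (f x) powr p"]
      by (intro integral_mono) (auto simp: carr_Lp indicator_def)
    finally have "norm (average M A f) powr p \<le> (1 / measure M A) * (LINT x|M. norm (f x) powr p)"
      using m by (simp add: field_simps)
    then have "(norm (average M A f) powr p) powr (1 / p) \<le> ((1 / measure M A) * (LINT x|M. norm (f x) powr p)) powr (1 / p)"
      using p by (intro powr_mono2) auto
    then have "norm (average M A f) \<le> ((1 / measure M A) * (LINT x|M. norm (f x) powr p)) powr (1 / p)"
      using p by (simp add: powr_powr)
    also have "\<dots> = (1 / measure M A) powr (1 / p) * (LINT x|M. norm (f x) powr p) powr (1 / p)"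
      by (rule powr_mult)
    finally show ?thesis by (simp only: nrm_Lp)
  qed
  ultimately show ?thesis
    unfolding dual_def by blast
qed

text \<open>For a finite disjoint family this is the conditional expectation on its blocks, extended
  by 0 off their union; its range is spanned by finitely many indicators.\<close>

definition averaging :: "'a measure \<Rightarrow> 'a set set \<Rightarrow> ('a \<Rightarrow> complex) \<Rightarrow> 'a \<Rightarrow> complex" where
  "averaging M P f = (\<lambda>x. \<Sum>A\<in>P. average M A f * of_real (indicator A x))"

text \<open>The last assumption replaces a fixed indicator expression, so that one lemma covers the
  sums below, whether the indicator is a left or right factor, real or complex.\<close>

lemma sum_indicator_disjoint:
  fixes c :: "'a set \<Rightarrow> 'b::semiring_1"
  assumes "finite P" "disjoint P" "A \<in> P" "x \<in> A" "\<And>B. h B = (if x \<in> B then c B else 0)"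
  shows "(\<Sum>B\<in>P. h B) = c A"
proof -
  have "(\<Sum>B\<in>P. h B) = (\<Sum>B\<in>P. if B = A then c B else 0)"
    using assms(2-5) by (intro sum.cong) (auto dest: disjointD)
  then show ?thesis using assms by simp
qed

context
  fixes M :: "'a measure" and P :: "'a set set" and p :: real
  assumes p: "1 \<le> p" and P: "finite P" "disjoint P" "P \<subseteq> sets M" "\<And>A. A \<in> P \<Longrightarrow> emeasure M A < \<infinity>"
begin

lemma averaging_eq: "x \<in> A \<Longrightarrow> A \<in> P \<Longrightarrow> averaging M P f x = average M A f"
  unfolding averaging_def using P by (intro sum_indicator_disjoint) auto

lemma averaging_eq_0: "x \<notin> \<Union>P \<Longrightarrow> averaging M P f x = 0"
  unfolding averaging_def by (intro sum.neutral) (auto simp: indicator_def)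

text \<open>Disjointness lets the p-th power pass inside the sum over blocks; Jensen's inequality
  holds on each block, and the integrals of \<open>norm (f x) powr p\<close> over disjoint blocks
  add up to at most the whole integral.\<close>

lemma averaging_contraction:
  assumes f: "f \<in> carr (Lp M p)"
  shows "nrm (Lp M p) (averaging M P f) \<le> nrm (Lp M p) f"
proof -
  have fin: "measure M A \<ge> 0" "integrable M (indicator A :: 'a \<Rightarrow> real)" "A \<in> sets M" if "A \<in> P" for A
    using P that by auto
  have ip: "integrable M (\<lambda>x. norm (f x) powr p)"
    using f by (simp add: carr_Lp)
  have ip': "integrable M (\<lambda>x. indicator A x * norm (f x) powr p)" if "A \<in> P" for A
    using integrable_mult_indicator[OF fin(3)[OF that] ip] by simp
  have "norm (averaging M P f x) powr p = (\<Sum>A\<in>P. norm (average M A f) powr p * indicator A x)" for x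
  proof (cases "x \<in> \<Union>P")
    case True
    then obtain A where A: "x \<in> A" "A \<in> P" by auto
    have "(\<Sum>B\<in>P. norm (average M B f) powr p * indicator B x) = norm (average M A f) powr p"
      by (rule sum_indicator_disjoint[OF P(1,2) A(2,1)]) (auto simp: indicator_def)
    then show ?thesis using A by (simp add: averaging_eq)
  next
    case False
    then have "(\<Sum>A\<in>P. norm (average M A f) powr p * indicator A x) = 0"
      by (intro sum.neutral) (auto simp: indicator_def)
    then show ?thesis using False p by (simp add: averaging_eq_0)
  qed
  then have "(LINT x|M. norm (averaging M P f x) powr p) =
      (LINT x|M. (\<Sum>A\<in>P. norm (average M A f) powr p * indicator A x))"
    by presburger
  also have "\<dots> = (\<Sum>A\<in>P. LINT x|M. norm (average M A f) powr p * indicator A x)"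
    using fin by (intro Bochner_Integration.integral_sum integrable_mult_right) auto
  also have "\<dots> = (\<Sum>A\<in>P. norm (average M A f) powr p * measure M A)"
    using fin P(3,4) by (intro sum.cong) auto
  also have "\<dots> \<le> (\<Sum>A\<in>P. LINT x|M. indicator A x * norm (f x) powr p)"
    using P by (intro sum_mono average_powr_le p f) auto
  also have "\<dots> = (LINT x|M. (\<Sum>A\<in>P. indicator A x * norm (f x) powr p))"
    by (rule Bochner_Integration.integral_sum[symmetric]) (rule ip')
  also have "\<dots> \<le> (LINT x|M. norm (f x) powr p)"
  proof (rule integral_mono[OF Bochner_Integration.integrable_sum[OF ip'] ip])
    fix x
    show "(\<Sum>A\<in>P. indicator A x * norm (f x) powr p) \<le> norm (f x) powr p"
    proof (cases "x \<in> \<Union>P")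
      case True
      then obtain A where A: "x \<in> A" "A \<in> P" by auto
      have "(\<Sum>B\<in>P. indicator B x * norm (f x) powr p) = norm (f x) powr p"
        by (rule sum_indicator_disjoint[OF P(1,2) A(2,1)]) (auto simp: indicator_def)
      then show ?thesis by simp
    next
      case False
      then have "(\<Sum>A\<in>P. indicator A x * norm (f x) powr p) = 0"
        by (intro sum.neutral) (auto simp: indicator_def)
      then show ?thesis by simp
    qed
  qed
  finally have "(LINT x|M. norm (averaging M P f x) powr p) \<le> nrm (Lp M p) f powr p"
    using p by (simp add: nrm_Lp_powr)
  then show ?thesis
    using p by (simp add: nrm_Lp_le_iff nrm_Lp_nonneg)
qed

text \<open>Only almost everywhere: on null sets \<open>A\<close> the average is \<open>0 / 0 = 0\<close>.\<close>

lemma averaging_fixes: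
  assumes s: "s \<in> borel_measurable M" and const: "\<And>A x y. A \<in> P \<Longrightarrow> x \<in> A \<Longrightarrow> y \<in> A \<Longrightarrow> s x = s y"
    and zero: "\<And>x. x \<in> space M \<Longrightarrow> x \<notin> \<Union>P \<Longrightarrow> s x = 0"
  shows "nrm (Lp M p) (\<lambda>x. s x - averaging M P s x) = 0"
proof -
  have "AE x in M. x \<notin> A" if "A \<in> P" "measure M A = 0" for A
    using P(3) P(4)[OF that(1)] that by (intro AE_not_in) (auto simp: null_sets_def measure_def enn2real_eq_0_iff)
  then have "AE x in M. \<forall>A\<in>{A\<in>P. measure M A = 0}. x \<notin> A"
    using P(1) by (intro AE_finite_allI) auto
  then have "AE x in M. norm (s x - averaging M P s x) powr p = 0"
    using AE_space
  proof eventually_elim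
    case (elim x)
    show ?case
    proof (cases "x \<in> \<Union>P")
      case True
      then obtain A where A: "x \<in> A" "A \<in> P" by auto
      then have m: "measure M A \<noteq> 0" using elim by auto
      have "of_real (indicator A z) * s z = of_real (indicator A z) * s x" for z
        using const[OF A(2,1), of z] by (auto simp: indicator_def)
      then have "average M A s = (LINT z|M. of_real (indicator A z) * s x) / of_real (measure M A)"
        by (simp only: average_def)
      also have "(LINT z|M. of_real (indicator A z) * s x) = of_real (measure M A) * s x"
        using P(4)[OF A(2)] sets.sets_into_space[of A M] P(3) A(2) by (simp add: Int_absorb2 subsetD)
      finally have "average M A s = s x"
        using m by simp
      then show ?thesis using A p by (simp add: averaging_eq)
    next
      case False
      then show ?thesis using elim zero p by (simp add: averaging_eq_0)
    qed
  qed
  then have "(LINT x|M. norm (s x - averaging M P s x) powr p) = 0"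
    by (rule integral_eq_zero_AE)
  then show ?thesis using p by (simp add: nrm_Lp)
qed

end

section \<open>Simple functions and the approximation property of \<open>Lp\<close>\<close>

lemma simple_functions_partition:
  fixes S :: "('a \<Rightarrow> 'b::zero) set"
  assumes "finite S" and simple: "\<And>s. s \<in> S \<Longrightarrow> simple_function M s"
    and fin: "\<And>s c. s \<in> S \<Longrightarrow> c \<noteq> 0 \<Longrightarrow> emeasure M (s -` {c} \<inter> space M) < \<infinity>"
  obtains P where "finite P" "disjoint P" "P \<subseteq> sets M" "\<And>A. A \<in> P \<Longrightarrow> emeasure M A < \<infinity>"
    "\<And>s A x y. s \<in> S \<Longrightarrow> A \<in> P \<Longrightarrow> x \<in> A \<Longrightarrow> y \<in> A \<Longrightarrow> s x = s y"
    "\<And>s x. s \<in> S \<Longrightarrow> x \<in> space M \<Longrightarrow> x \<notin> \<Union>P \<Longrightarrow> s x = 0"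
proof -
  define C where "C v = {z \<in> space M. \<forall>s\<in>S. s z = v s}" for v
  \<comment> \<open>The blocks are the joint level sets of all functions in \<open>S\<close>. The
    common zero set is left out, as it may have infinite measure; every other block lies in a
    nonzero level set of some \<open>s\<close>, which has finite measure.\<close>
  define P where "P = (\<lambda>x. C (\<lambda>s. s x)) ` {x \<in> space M. \<exists>s\<in>S. s x \<noteq> 0}"
  have C_sets: "C v \<in> sets M" for v
  proof -
    have "s -` {v s} \<inter> space M \<in> sets M" if "s \<in> S" for s
      using simple_functionD(2)[OF simple[OF that]] .
    then have "(\<Inter>s\<in>S. s -` {v s} \<inter> space M) \<in> sets M" if "S \<noteq> {}"
      using \<open>finite S\<close> that by (intro sets.finite_INT) auto
    moreover have "C v = (if S = {} then space M else (\<Inter>s\<in>S. s -` {v s} \<inter> space M))"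
      by (auto simp: C_def)
    ultimately show ?thesis by simp
  qed
  \<comment> \<open>\<open>C v\<close> depends only on the values of \<open>v\<close> on
    \<open>S\<close>, and each \<open>s\<close> takes finitely many values, so finitely many blocks
    occur.\<close>
  have "P \<subseteq> C ` (PiE S (\<lambda>s. s ` space M))"
  proof
    fix A assume "A \<in> P"
    then obtain x where x: "x \<in> space M" "A = C (\<lambda>s. s x)" by (auto simp: P_def)
    then have "A = C (restrict (\<lambda>s. s x) S)" by (auto simp: C_def)
    moreover have "restrict (\<lambda>s. s x) S \<in> PiE S (\<lambda>s. s ` space M)" using x by auto
    ultimately show "A \<in> C ` (PiE S (\<lambda>s. s ` space M))" by blast
  qed
  moreover have "finite (PiE S (\<lambda>s. s ` space M))"
    using \<open>finite S\<close> simple by (intro finite_PiE) (auto dest: simple_functionD(1))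
  ultimately have 1: "finite P"
    using finite_subset by blast
  have 2: "disjoint P"
    unfolding disjoint_def P_def C_def by (auto; metis)
  have 3: "P \<subseteq> sets M"
    using C_sets by (auto simp: P_def)
  have 4: "emeasure M A < \<infinity>" if "A \<in> P" for A
  proof -
    from that obtain x s where x: "A = C (\<lambda>s. s x)" "s \<in> S" "s x \<noteq> 0" by (auto simp: P_def)
    then have "A \<subseteq> s -` {s x} \<inter> space M" by (auto simp: C_def)
    then have "emeasure M A \<le> emeasure M (s -` {s x} \<inter> space M)"
      using simple_functionD(2)[OF simple[OF x(2)]] by (rule emeasure_mono)
    then show ?thesis using fin[OF x(2,3)] by (rule le_less_trans)
  qed
  show ?thesis
  proof (rule that[OF 1 2 3 4])
    show "s x = s y" if "s \<in> S" "A \<in> P" "x \<in> A" "y \<in> A" for s A x y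
      using that by (auto simp: P_def C_def)
    show "s x = 0" if "s \<in> S" "x \<in> space M" "x \<notin> \<Union>P" for s x
      using that by (auto simp: P_def C_def)
  qed
qed

text \<open>The pointwise approximation satisfies \<open>norm (F i x) \<le> 2 * norm (f x)\<close>,
  so the error is at most \<open>3 * norm (f x)\<close> and dominated convergence applies. The level
  set of \<open>c \<noteq> 0\<close> has finite measure because \<open>norm c powr p\<close> times
  its indicator is below \<open>norm (F i x) powr p\<close>.\<close>

lemma simple_functions_dense_Lp:
  assumes p: "1 \<le> p" and f: "f \<in> carr (Lp M p)" and "\<epsilon> > 0"
  obtains s where "simple_function M s" "s \<in> carr (Lp M p)"
    "\<And>c. c \<noteq> 0 \<Longrightarrow> emeasure M (s -` {c} \<inter> space M) < \<infinity>"
    "nrm (Lp M p) (\<lambda>x. f x - s x) \<le> \<epsilon>"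
proof -
  have fm[measurable]: "f \<in> borel_measurable M" and fi: "integrable M (\<lambda>x. norm (f x) powr p)"
    using f by (auto simp: carr_Lp)
  obtain F where F: "\<And>i. simple_function M (F i)" "\<And>x. x \<in> space M \<Longrightarrow> (\<lambda>i. F i x) \<longlonglongrightarrow> f x"
    "\<And>i x. x \<in> space M \<Longrightarrow> norm (F i x) \<le> 2 * norm (f x)"
    using borel_measurable_implies_sequence_metric[OF fm, of 0] by simp metis
  have [measurable]: "F i \<in> borel_measurable M" for i
    using F(1) by (rule borel_measurable_simple_function)
  have "(\<lambda>i. LINT x|M. norm (f x - F i x) powr p) \<longlonglongrightarrow> (LINT x|M. 0)"
  proof (rule integral_dominated_convergence[where w = "\<lambda>x. 3 powr p * norm (f x) powr p"])
    show "integrable M (\<lambda>x. 3 powr p * norm (f x) powr p)" using fi by simp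
    show "AE x in M. (\<lambda>i. norm (f x - F i x) powr p) \<longlonglongrightarrow> 0"
    proof (rule AE_I2)
      fix x assume "x \<in> space M"
      then have "(\<lambda>i. norm (f x - F i x)) \<longlonglongrightarrow> norm (f x - f x)"
        by (intro tendsto_intros F)
      then have "(\<lambda>i. norm (f x - F i x)) \<longlonglongrightarrow> 0" by simp
      then have "(\<lambda>i. norm (f x - F i x) powr p) \<longlonglongrightarrow> 0 powr p"
        using p by (intro tendsto_powr') auto
      then show "(\<lambda>i. norm (f x - F i x) powr p) \<longlonglongrightarrow> 0" using p by simp
    qed
    show "AE x in M. norm (norm (f x - F i x) powr p) \<le> 3 powr p * norm (f x) powr p" for i
    proof (rule AE_I2)
      fix x assume "x \<in> space M"
      then have "norm (f x - F i x) \<le> 3 * norm (f x)"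
        using norm_triangle_ineq4[of "f x" "F i x"] F(3)[of x i] by simp
      then have "norm (f x - F i x) powr p \<le> (3 * norm (f x)) powr p"
        using p by (intro powr_mono2) auto
      then show "norm (norm (f x - F i x) powr p) \<le> 3 powr p * norm (f x) powr p"
        by (simp add: powr_mult)
    qed
  qed auto
  then have "eventually (\<lambda>i. (LINT x|M. norm (f x - F i x) powr p) < \<epsilon> powr p) sequentially"
    using \<open>\<epsilon> > 0\<close> by (intro order_tendstoD(2)[of _ 0]) auto
  then obtain i where i: "(LINT x|M. norm (f x - F i x) powr p) < \<epsilon> powr p"
    by (auto simp: eventually_sequentially)
  have int: "integrable M (\<lambda>x. norm (F i x) powr p)"
  proof (rule Bochner_Integration.integrable_bound)
    show "integrable M (\<lambda>x. 2 powr p * norm (f x) powr p)" using fi by simp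
    show "AE x in M. norm (norm (F i x) powr p) \<le> norm (2 powr p * norm (f x) powr p)"
    proof (rule AE_I2)
      fix x assume "x \<in> space M"
      then have "norm (F i x) powr p \<le> (2 * norm (f x)) powr p"
        using p F(3)[of x i] by (intro powr_mono2) auto
      then show "norm (norm (F i x) powr p) \<le> norm (2 powr p * norm (f x) powr p)"
        by (simp add: powr_mult)
    qed
  qed measurable
  show ?thesis
  proof (rule that[OF F(1)[of i]])
    show "F i \<in> carr (Lp M p)"
      using int by (simp add: carr_Lp)
    show "nrm (Lp M p) (\<lambda>x. f x - F i x) \<le> \<epsilon>"
      using i p \<open>\<epsilon> > 0\<close> by (simp add: nrm_Lp_le_iff)
    fix c :: complex assume "c \<noteq> 0"
    let ?A = "F i -` {c} \<inter> space M"
    have A: "?A \<in> sets M" by (rule simple_functionD(2)[OF F(1)])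
    have "integrable M (\<lambda>x. norm c powr p * indicator ?A x)"
    proof (rule Bochner_Integration.integrable_bound[OF int])
      show "(\<lambda>x. norm c powr p * indicator ?A x) \<in> borel_measurable M" using A by simp
    qed (auto simp: indicator_def)
    then have "integrable M (\<lambda>x. inverse (norm c powr p) * (norm c powr p * indicator ?A x))"
      by (rule integrable_mult_right)
    then have "integrable M (indicator ?A :: 'a \<Rightarrow> real)"
      using \<open>c \<noteq> 0\<close> by (simp add: mult.assoc[symmetric])
    then show "emeasure M ?A < \<infinity>"
      using A by (simp add: integrable_indicator_iff)
  qed
qed

lemma indicator_in_Lp:
  assumes "1 \<le> p" "A \<in> sets M" "emeasure M A < \<infinity>"
  shows "(\<lambda>x. of_real (indicator A x)) \<in> carr (Lp M p)"
proof -
  have "norm (of_real (indicator A x) :: complex) powr p = indicator A x" for x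
    using assms(1) by (auto simp: indicator_def)
  then show ?thesis using assms by (simp add: carr_Lp)
qed

text \<open>Take the joint level sets of simple functions within \<open>\<epsilon> / 2\<close> of
  each \<open>y\<close>. In \<open>y - P y = (y - s) + (s - P s) - P (y - s)\<close>, where
  \<open>P\<close> is the averaging operator, the middle term has norm 0 and the contraction bounds
  the last by the first.\<close>

theorem metric_approximation_property_Lp:
  fixes M :: "'a measure"
  assumes p: "1 \<le> p"
  shows "metric_approximation_property (Lp M p)"
  unfolding metric_approximation_property_def
proof (intro allI impI)
  fix Y and \<epsilon> :: real
  assume Y: "finite Y" "Y \<subseteq> carr (Lp M p)" and "0 < \<epsilon>"
  interpret seminormed_fun_space "Lp M p" by (rule seminormed_Lp[OF p])
  have "\<exists>s. simple_function M s \<and> s \<in> carr (Lp M p) \<and>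
    (\<forall>c. c \<noteq> 0 \<longrightarrow> emeasure M (s -` {c} \<inter> space M) < \<infinity>) \<and>
    nrm (Lp M p) (\<lambda>x. y x - s x) \<le> \<epsilon> / 2" if "y \<in> Y" for y
    using simple_functions_dense_Lp[OF p, of y M "\<epsilon> / 2"] that Y(2) \<open>0 < \<epsilon>\<close>
    by (metis half_gt_zero subsetD)
  then obtain s where s: "\<And>y. y \<in> Y \<Longrightarrow> simple_function M (s y)" "\<And>y. y \<in> Y \<Longrightarrow> s y \<in> carr (Lp M p)"
    "\<And>y c. y \<in> Y \<Longrightarrow> c \<noteq> 0 \<Longrightarrow> emeasure M (s y -` {c} \<inter> space M) < \<infinity>"
    "\<And>y. y \<in> Y \<Longrightarrow> nrm (Lp M p) (\<lambda>x. y x - s y x) \<le> \<epsilon> / 2"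
    by metis
  obtain P where P: "finite P" "disjoint P" "P \<subseteq> sets M" "\<And>A. A \<in> P \<Longrightarrow> emeasure M A < \<infinity>"
    "\<And>t A x y. t \<in> s ` Y \<Longrightarrow> A \<in> P \<Longrightarrow> x \<in> A \<Longrightarrow> y \<in> A \<Longrightarrow> t x = t y"
    "\<And>t x. t \<in> s ` Y \<Longrightarrow> x \<in> space M \<Longrightarrow> x \<notin> \<Union>P \<Longrightarrow> t x = 0"
    by (rule simple_functions_partition[of "s ` Y" M]) (use Y s in auto)
  obtain b where b: "bij_betw b {..<card P} P"
    using ex_bij_betw_nat_finite[OF P(1)] by (auto simp: atLeast0LessThan)
  then have bP: "b j \<in> P" if "j < card P" for j
    using that by (auto simp: bij_betw_def)
  define g where "g j = average M (b j)" for j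
  define h where "h j = (\<lambda>x. of_real (indicator (b j) x) :: complex)" for j
  have av: "(\<lambda>x. \<Sum>j<card P. g j f * h j x) = averaging M P f" for f
    unfolding averaging_def g_def h_def
    by (rule ext) (rule sum.reindex_bij_betw[OF b, of "\<lambda>A. average M A f * of_real (indicator A x)" for x])
  have gd: "g j \<in> dual (Lp M p)" and hc: "h j \<in> carr (Lp M p)" if "j < card P" for j
    unfolding g_def h_def using bP[OF that] P(3,4) p
    by (auto intro!: average_in_dual indicator_in_Lp)
  have avc: "averaging M P f \<in> carr (Lp M p)" for f
    unfolding av[symmetric] by (rule carr_sum) (auto simp: hc)
  have avn: "nrm (Lp M p) (averaging M P f) \<le> nrm (Lp M p) f" if "f \<in> carr (Lp M p)" for f
    by (rule averaging_contraction[OF p P(1-4) that])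
  have "finite_rank_contraction (Lp M p) (card P) g h"
    unfolding finite_rank_contraction_def av by (auto simp: gd hc avn)
  moreover have "nrm (Lp M p) (\<lambda>x. y x - averaging M P y x) \<le> \<epsilon>" if y: "y \<in> Y" for y
  proof -
    note sy = s[OF y]
    have yc: "y \<in> carr (Lp M p)" using y Y by auto
    have dc: "(\<lambda>x. y x - s y x) \<in> carr (Lp M p)" by (rule carr_diff[OF yc sy(2)])
    have "averaging M P (\<lambda>x. y x - s y x) x = averaging M P y x - averaging M P (s y) x" for x
    proof -
      have "average M A (\<lambda>x. y x - s y x) = average M A y - average M A (s y)" if "A \<in> P" for A
        using P(3,4) that p by (intro dual_diff average_in_dual yc sy) auto
      then show ?thesis
        by (simp add: averaging_def sum_subtractf[symmetric] left_diff_distrib)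
    qed
    then have eq: "(\<lambda>x. y x - averaging M P y x) =
       (\<lambda>x. ((y x - s y x) + (s y x - averaging M P (s y) x)) - averaging M P (\<lambda>x. y x - s y x) x)"
      by auto
    have fixed: "nrm (Lp M p) (\<lambda>x. s y x - averaging M P (s y) x) = 0"
      by (rule averaging_fixes[OF p P(1-4)]) (use sy(2) P(5,6) y in \<open>auto simp: carr_Lp\<close>)
    have c1: "(\<lambda>x. s y x - averaging M P (s y) x) \<in> carr (Lp M p)"
      by (rule carr_diff[OF sy(2) avc])
    have "nrm (Lp M p) (\<lambda>x. y x - averaging M P y x) \<le>
       nrm (Lp M p) (\<lambda>x. (y x - s y x) + (s y x - averaging M P (s y) x)) +
       nrm (Lp M p) (averaging M P (\<lambda>x. y x - s y x))"
      unfolding eq by (rule nrm_diff[OF carr_add[OF dc c1] avc])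
    also have "\<dots> \<le> (nrm (Lp M p) (\<lambda>x. y x - s y x) + 0) + nrm (Lp M p) (\<lambda>x. y x - s y x)"
      using nrm_add[OF dc c1] avn[OF dc] fixed by simp
    also have "\<dots> \<le> \<epsilon>" using sy(4) by simp
    finally show ?thesis .
  qed
  ultimately show "\<exists>m g h. finite_rank_contraction (Lp M p) m g h \<and>
      (\<forall>y\<in>Y. nrm (Lp M p) (\<lambda>x. y x - (\<Sum>j<m. g j y * h j x)) \<le> \<epsilon>)"
    by (intro exI[of _ "card P"] exI[of _ g] exI[of _ h]) (auto simp: fun_cong[OF av])
qed

subsection \<open>Hermite functions of one variable\<close>

text \<open>The recursion is one further differentiation in Rodrigues' formula. Working with
  polynomials makes derivatives algebraic and integrability against the Gaussian automatic.\<close>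

fun hpoly :: "nat \<Rightarrow> real poly" where
  "hpoly 0 = 1"
| "hpoly (Suc k) = [:0, 2:] * hpoly k - pderiv (hpoly k)"

text \<open>Differentiating the recursion leaves \<open>2 * hpoly (Suc k)\<close> plus the recursion
  expression for the derivative of \<open>hpoly (Suc k)\<close>; the induction hypothesis turns the
  latter into a multiple of the recursion for \<open>hpoly (Suc k)\<close> itself.\<close>

lemma pderiv_hpoly_Suc: "pderiv (hpoly (Suc k)) = smult (2 * (real k + 1)) (hpoly k)"
proof (induction k)
  case 0
  show ?case by (simp add: pderiv_pCons)
next
  case (Suc k)
  have "pderiv (hpoly (Suc (Suc k))) =
      smult 2 (hpoly (Suc k)) + ([:0, 2:] * pderiv (hpoly (Suc k)) - pderiv (pderiv (hpoly (Suc k))))"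
    by (simp only: hpoly.simps(2)[of "Suc k"] pderiv_diff pderiv_mult) (simp add: pderiv_pCons)
  also have "[:0, 2:] * pderiv (hpoly (Suc k)) - pderiv (pderiv (hpoly (Suc k)))
      = smult (2 * (real k + 1)) (hpoly (Suc k))"
    unfolding Suc.IH pderiv_smult by (simp only: hpoly.simps(2)[of k] smult_diff_right mult_smult_right)
  finally show ?case
    by (simp only: smult_add_left[symmetric]) (simp add: algebra_simps)
qed

lemma hpoly_Suc_Suc:
  "hpoly (Suc (Suc k)) = [:0, 2:] * hpoly (Suc k) - smult (2 * (real k + 1)) (hpoly k)"
  by (simp only: hpoly.simps(2)[of "Suc k"] pderiv_hpoly_Suc)

lemma higher_deriv_gaussian:
  "(deriv ^^ k) (\<lambda>u. exp (- u\<^sup>2)) = (\<lambda>x. (-1) ^ k * poly (hpoly k) x * exp (- x\<^sup>2 :: real))"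
proof (induction k)
  case 0
  show ?case by simp
next
  case (Suc k)
  have "((\<lambda>x. (-1) ^ k * poly (hpoly k) x * exp (- x\<^sup>2)) has_real_derivative
      (-1) ^ Suc k * poly (hpoly (Suc k)) x * exp (- x\<^sup>2)) (at x)" for x :: real
    by (auto intro!: derivative_eq_intros simp: algebra_simps)
  then show ?case
    by (simp only: funpow.simps o_apply Suc.IH) (blast intro: DERIV_imp_deriv)
qed

lemma hermite_poly_eq: "hermite_poly k = poly (hpoly k)"
proof
  fix x
  have "hermite_poly k x = ((-1) ^ k * (-1) ^ k) * (exp (x\<^sup>2) * exp (- x\<^sup>2)) * poly (hpoly k) x"
    by (simp only: hermite_poly_def higher_deriv_gaussian mult_ac)
  then show "hermite_poly k x = poly (hpoly k) x"
    by (simp add: exp_minus power_mult_distrib[symmetric])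
qed

definition hermite_const :: "nat \<Rightarrow> real" where
  "hermite_const k = (2 ^ k * fact k * sqrt pi) powr (- 1 / 2)"

lemma hermite_fun1_eq: "hermite_fun1 k x = hermite_const k * poly (hpoly k) x * exp (- x\<^sup>2 / 2)"
  by (simp add: hermite_fun1_def hermite_const_def hermite_poly_eq)

lemma hermite_const_pos: "hermite_const k > 0"
  by (simp add: hermite_const_def)

lemma hermite_const_sq: "(hermite_const k)\<^sup>2 = 1 / (2 ^ k * fact k * sqrt pi)"
proof -
  have "(hermite_const k)\<^sup>2 = (2 ^ k * fact k * sqrt pi) powr (- 1)"
    unfolding hermite_const_def power2_eq_square powr_add[symmetric] by simp
  then show ?thesis
    by (simp add: powr_minus_divide)
qed

lemma hermite_const_Suc: "hermite_const k = sqrt (2 * (real k + 1)) * hermite_const (Suc k)"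
proof (rule power2_eq_imp_eq)
  show "(hermite_const k)\<^sup>2 = (sqrt (2 * (real k + 1)) * hermite_const (Suc k))\<^sup>2"
  proof -
    have "1 / (2 ^ k * fact k * sqrt pi) = 2 * c * (1 / (2 * 2 ^ k * (c * fact k) * sqrt pi))"
      if "c > 0" for c :: real
      using that by (simp add: field_simps)
    from this[of "real k + 1"] show ?thesis
      unfolding power_mult_distrib hermite_const_sq by (simp add: add.commute)
  qed
qed (auto intro!: mult_nonneg_nonneg less_imp_le[OF hermite_const_pos])

text \<open>Converts the factor from \<open>hermite_const_Suc\<close> into the coefficients
  \<open>sqrt (a / 2)\<close> of the ladder relations.\<close>

lemma sqrt_double: "sqrt (2 * a) = 2 * sqrt (a / 2)"
  using real_sqrt_mult[of 4 "a / 2"] by simp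

lemma hermite_fun1_0: "hermite_fun1 0 x = hermite_const 0 * exp (- x\<^sup>2 / 2)"
  by (simp add: hermite_fun1_eq)

text \<open>The three-term recurrence \<open>hpoly_Suc_Suc\<close>, solved for \<open>x\<close>
  times the polynomial and normalised: \<open>x\<close> is a multiple of the sum of the raising and
  lowering operators.\<close>

lemma x_hermite_fun1_Suc:
  "x * hermite_fun1 (Suc k) x =
     sqrt ((real k + 2) / 2) * hermite_fun1 (Suc (Suc k)) x + sqrt ((real k + 1) / 2) * hermite_fun1 k x"
proof -
  have "hermite_const (Suc k) * (x * poly (hpoly (Suc k)) x) =
      hermite_const (Suc k) * (poly (hpoly (Suc (Suc k))) x / 2 + (real k + 1) * poly (hpoly k) x)"
    by (simp only: hpoly_Suc_Suc poly_diff poly_mult poly_smult) (simp add: field_simps)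
  also have "\<dots> = sqrt ((real k + 2) / 2) * hermite_const (Suc (Suc k)) * poly (hpoly (Suc (Suc k))) x
      + sqrt ((real k + 1) / 2) * hermite_const k * poly (hpoly k) x"
  proof -
    have "hermite_const (Suc k) / 2 = sqrt ((real k + 2) / 2) * hermite_const (Suc (Suc k))"
      using hermite_const_Suc[of "Suc k"] sqrt_double[of "real k + 2"] by (simp add: add.commute)
    moreover have "hermite_const (Suc k) * (real k + 1) = sqrt ((real k + 1) / 2) * hermite_const k"
    proof -
      have "sqrt ((real k + 1) / 2) * (2 * sqrt ((real k + 1) / 2) * c) = c * (real k + 1)" for c
        using real_sqrt_mult_self[of "(real k + 1) / 2"] by (simp add: mult_ac)
      then show ?thesis
        by (simp only: hermite_const_Suc[of k] sqrt_double)
    qed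
    ultimately show ?thesis
      by (simp add: distrib_left)
  qed
  finally have "hermite_const (Suc k) * (x * poly (hpoly (Suc k)) x) = \<dots>" .
  from arg_cong[OF this, of "\<lambda>z. z * exp (- x\<^sup>2 / 2)"] show ?thesis
    by (simp add: hermite_fun1_eq algebra_simps del: hpoly.simps)
qed

lemma x_hermite_fun1_0: "x * hermite_fun1 0 x = sqrt (1 / 2) * hermite_fun1 1 x"
proof -
  have "hermite_const 0 = sqrt 2 * hermite_const 1"
    using hermite_const_Suc[of 0] by simp
  then show ?thesis
    using sqrt_double[of 1] by (simp add: hermite_fun1_eq)
qed

text \<open>The recursion for \<open>hpoly (Suc k)\<close> read as a formula for the derivative of
  \<open>hpoly k\<close>. In this form it also covers \<open>k = 0\<close>.\<close>

lemma has_real_derivative_hermite_fun1: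
  "(hermite_fun1 k has_real_derivative
      (x * hermite_fun1 k x - sqrt (2 * (real k + 1)) * hermite_fun1 (Suc k) x)) (at x)"
proof -
  have "hermite_const k * poly (pderiv (hpoly k)) x * exp (- x\<^sup>2 / 2) =
      2 * x * hermite_fun1 k x - sqrt (2 * (real k + 1)) * hermite_fun1 (Suc k) x"
    unfolding hermite_fun1_eq by (subst (1 2) hermite_const_Suc) (simp add: algebra_simps)
  then show ?thesis
    unfolding hermite_fun1_eq[abs_def]
    by (auto intro!: derivative_eq_intros simp: hermite_fun1_eq algebra_simps)
qed

text \<open>Inserting the three-term relation removes the factor \<open>x\<close>, so the derivative
  is visibly a combination of square-integrable functions with known norms.\<close>

lemma has_real_derivative_hermite_fun1_Suc:
  "(hermite_fun1 (Suc k) has_real_derivative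
      (sqrt ((real k + 1) / 2) * hermite_fun1 k x - sqrt ((real k + 2) / 2) * hermite_fun1 (Suc (Suc k)) x)) (at x)"
proof -
  have "sqrt (2 * (real k + 2)) = 2 * sqrt ((real k + 2) / 2)"
    by (rule sqrt_double)
  then show ?thesis
    using has_real_derivative_hermite_fun1[of "Suc k" x]
    by (simp add: x_hermite_fun1_Suc add_ac mult_ac)
qed

lemma continuous_on_hermite_fun1 [continuous_intros]: "continuous_on S (hermite_fun1 k)"
  unfolding hermite_fun1_eq[abs_def] by (intro continuous_intros) auto

lemma borel_measurable_hermite_fun1 [measurable]: "hermite_fun1 k \<in> borel_measurable borel"
  by (rule borel_measurable_continuous_onI) (rule continuous_on_hermite_fun1)

subsection \<open>Normalisation\<close>

text \<open>The Gaussian is \<open>sqrt pi\<close> times the normal density with standard deviation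
  \<open>1 / sqrt 2\<close>, whose moments are integrable.\<close>

lemma integrable_poly_gaussian: "integrable lborel (\<lambda>x::real. poly p x * exp (- x\<^sup>2))"
proof -
  have "normal_density 0 (1 / sqrt 2) x * x ^ i = (x ^ i * exp (- x\<^sup>2)) * (1 / sqrt pi)" for x :: real and i
    by (simp add: normal_density_def power_divide)
  moreover have "integrable lborel (\<lambda>x. normal_density 0 (1 / sqrt 2) x * (x - 0) ^ i)" for i
    by (rule integrable_normal_moment) simp
  ultimately have "integrable lborel (\<lambda>x::real. (x ^ i * exp (- x\<^sup>2)) * (1 / sqrt pi))" for i
    by simp
  then have "integrable lborel (\<lambda>x::real. (x ^ i * exp (- x\<^sup>2)) * (1 / sqrt pi) * sqrt pi)" for i
    by (rule integrable_mult_left)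
  then have "integrable lborel (\<lambda>x::real. x ^ i * exp (- x\<^sup>2))" for i
    by simp
  then show ?thesis
    unfolding poly_altdef sum_distrib_right mult.assoc
    by (intro Bochner_Integration.integrable_sum integrable_mult_right)
qed

lemma tendsto_poly_gaussian:
  "((\<lambda>x::real. poly p x * exp (- x\<^sup>2)) \<longlongrightarrow> 0) at_top"
  "((\<lambda>x::real. poly p x * exp (- x\<^sup>2)) \<longlongrightarrow> 0) at_bot"
proof -
  have *: "((\<lambda>x::real. poly p x * exp (- x\<^sup>2)) \<longlongrightarrow> 0) at_top" for p
  proof -
    have "((\<lambda>x::real. x ^ i * exp (- x\<^sup>2)) \<longlongrightarrow> 0) at_top" for i
      by real_asymp
    then have "((\<lambda>x::real. \<Sum>i\<le>degree p. coeff p i * (x ^ i * exp (- x\<^sup>2))) \<longlongrightarrow>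
        (\<Sum>i\<le>degree p. coeff p i * 0)) at_top"
      by (intro tendsto_sum tendsto_mult tendsto_const) auto
    then show ?thesis
      unfolding poly_altdef sum_distrib_right mult.assoc by simp
  qed
  show "((\<lambda>x::real. poly p x * exp (- x\<^sup>2)) \<longlongrightarrow> 0) at_top"
    by (rule *)
  have "((\<lambda>x::real. poly p (- x) * exp (- (- x)\<^sup>2)) \<longlongrightarrow> 0) at_top"
    using *[of "pcompose p [:0, -1:]"] by (simp add: poly_pcompose)
  then show "((\<lambda>x::real. poly p x * exp (- x\<^sup>2)) \<longlongrightarrow> 0) at_bot"
    unfolding at_bot_mirror filterlim_filtermap by simp
qed

text \<open>Integration by parts: \<open>hpoly (Suc k) * hpoly k\<close> times the Gaussian vanishes
  at both ends, and its derivative is the polynomial \<open>q\<close> times the Gaussian, the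
  difference of the two integrands.\<close>

lemma LBINT_hpoly_Suc_sq:
  "(LBINT x. (poly (hpoly (Suc k)) x)\<^sup>2 * exp (- x\<^sup>2)) =
     2 * (real k + 1) * (LBINT x. (poly (hpoly k) x)\<^sup>2 * exp (- x\<^sup>2))"
proof -
  define q where "q = smult (2 * (real k + 1)) (hpoly k * hpoly k) - hpoly (Suc k) * hpoly (Suc k)"
  have d: "((\<lambda>x. poly (hpoly (Suc k) * hpoly k) x * exp (- x\<^sup>2)) has_real_derivative
      poly q x * exp (- x\<^sup>2)) (at x)" for x
  proof -
    have "((\<lambda>x. poly (hpoly (Suc k) * hpoly k) x * exp (- x\<^sup>2)) has_real_derivative
      (poly (pderiv (hpoly (Suc k)) * hpoly k + hpoly (Suc k) * (pderiv (hpoly k) - [:0,2:] * hpoly k)) x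
        * exp (- x\<^sup>2))) (at x)"
      by (auto intro!: derivative_eq_intros simp: pderiv_mult algebra_simps simp del: hpoly.simps)
    moreover have "pderiv (hpoly k) - [:0,2:] * hpoly k = - hpoly (Suc k)"
      by simp
    ultimately show ?thesis
      by (simp only: q_def pderiv_hpoly_Suc) (simp del: hpoly.simps)
  qed
  have "(LBINT x=-\<infinity>..\<infinity>. poly q x * exp (- x\<^sup>2)) = 0 - 0"
  proof (rule interval_integral_FTC_integrable)
    show "((\<lambda>x. poly (hpoly (Suc k) * hpoly k) x * exp (- x\<^sup>2)) has_vector_derivative
      poly q x * exp (- x\<^sup>2)) (at x)" for x
      using d by (simp add: has_real_derivative_iff_has_vector_derivative)
    show "set_integrable lborel (einterval (- \<infinity>) \<infinity>) (\<lambda>x. poly q x * exp (- x\<^sup>2))"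
      by (simp add: set_integrable_def integrable_poly_gaussian)
  qed (auto simp: ereal_tendsto_simps simp del: hpoly.simps poly_mult intro!: tendsto_poly_gaussian continuous_intros)
  then have "(LBINT x. poly q x * exp (- x\<^sup>2)) = 0"
    by (simp add: interval_lebesgue_integral_def set_lebesgue_integral_def)
  moreover have "(LBINT x. poly q x * exp (- x\<^sup>2)) =
     2 * (real k + 1) * (LBINT x. poly (hpoly k * hpoly k) x * exp (- x\<^sup>2))
     - (LBINT x. poly (hpoly (Suc k) * hpoly (Suc k)) x * exp (- x\<^sup>2))"
    using integrable_poly_gaussian[of "hpoly k * hpoly k"]
      integrable_poly_gaussian[of "hpoly (Suc k) * hpoly (Suc k)"]
    unfolding q_def poly_diff poly_smult left_diff_distrib mult.assoc
    by (subst Bochner_Integration.integral_diff) (auto simp del: hpoly.simps poly_mult)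
  ultimately show ?thesis
    by (simp add: power2_eq_square)
qed

lemma LBINT_hpoly_sq:
  "(LBINT x. (poly (hpoly k) x)\<^sup>2 * exp (- x\<^sup>2)) = 2 ^ k * fact k * sqrt pi"
proof (induction k)
  case 0
  have "(LBINT x. normal_density 0 (1 / sqrt 2) x) = 1"
    by (rule integral_normal_density) simp
  moreover have "normal_density 0 (1 / sqrt 2) x = exp (- x\<^sup>2) * (1 / sqrt pi)" for x :: real
    by (simp add: normal_density_def power_divide)
  ultimately show ?case by simp
next
  case (Suc k)
  then show ?case by (subst LBINT_hpoly_Suc_sq) simp
qed

lemma hermite_fun1_sq: "(hermite_fun1 k x)\<^sup>2 = (hermite_const k)\<^sup>2 * ((poly (hpoly k) x)\<^sup>2 * exp (- x\<^sup>2))"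
proof -
  have "(exp (- x\<^sup>2 / 2))\<^sup>2 = exp (- x\<^sup>2)"
    by (simp add: power2_eq_square exp_add[symmetric])
  then show ?thesis
    by (simp add: hermite_fun1_eq power_mult_distrib)
qed

lemma integrable_hermite_fun1_sq: "integrable lborel (\<lambda>x. (hermite_fun1 k x)\<^sup>2)"
  using integrable_poly_gaussian[of "hpoly k * hpoly k"]
  unfolding hermite_fun1_sq by (intro integrable_mult_right) (simp add: power2_eq_square)

lemma LBINT_hermite_fun1_sq: "(LBINT x. (hermite_fun1 k x)\<^sup>2) = 1"
  unfolding hermite_fun1_sq
  by (simp add: LBINT_hpoly_sq hermite_const_sq)

subsection \<open>A pointwise bound\<close>

text \<open>At 0 the three-term relation links indices two apart with a ratio of modulus below 1, so
  the values shrink from \<open>1 / sqrt pi\<close> (squared, even indices) and from 0 (odd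
  indices).\<close>

lemma hermite_fun1_at_0: "(hermite_fun1 k 0)\<^sup>2 \<le> 1"
proof (induction k rule: induct_nat_012)
  case 0
  have "1 \<le> sqrt pi" using pi_ge_two by simp
  then show ?case by (simp add: hermite_fun1_0 hermite_const_sq)
next
  case 1
  show ?case by (simp add: hermite_fun1_eq)
next
  case (ge2 k)
  have "sqrt ((real k + 2) / 2) * hermite_fun1 (Suc (Suc k)) 0 = - sqrt ((real k + 1) / 2) * hermite_fun1 k 0"
    using x_hermite_fun1_Suc[of 0 k] by simp
  from arg_cong[OF this, of "\<lambda>z. z\<^sup>2"]
  have "(real k + 2) * (hermite_fun1 (Suc (Suc k)) 0)\<^sup>2 = (real k + 1) * (hermite_fun1 k 0)\<^sup>2"
    by (simp add: power_mult_distrib)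
  also have "\<dots> \<le> (real k + 2) * 1"
    using ge2 by (intro mult_mono) auto
  finally show ?case by (simp del: mult_1_right)
qed

definition hermite_deriv1 :: "nat \<Rightarrow> real \<Rightarrow> real" where
  "hermite_deriv1 k x = x * hermite_fun1 k x - sqrt (2 * (real k + 1)) * hermite_fun1 (Suc k) x"

text \<open>The derivative combines two normalised neighbours; bounding
  \<open>(a - b)\<^sup>2\<close> by \<open>2 * a\<^sup>2 + 2 * b\<^sup>2\<close> removes the cross
  term. For \<open>k = Suc m\<close> the majorant integrates to
  \<open>(m + 1) + (m + 2) = 2 * k + 1\<close>.\<close>

lemma hermite_deriv1_sq:
  obtains g where "integrable lborel g" "\<And>x. (hermite_deriv1 k x)\<^sup>2 \<le> g x" "(LBINT x. g x) \<le> 2 * real k + 1"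
proof (cases k)
  case 0
  have sq: "sqrt (1/2) - sqrt 2 = - sqrt (1/2)"
    by (simp add: real_sqrt_divide field_simps)
  have "hermite_deriv1 k x = (sqrt (1/2) - sqrt 2) * hermite_fun1 1 x" for x
    by (simp add: hermite_deriv1_def 0 x_hermite_fun1_0 left_diff_distrib)
  then have "(hermite_deriv1 k x)\<^sup>2 = 1/2 * (hermite_fun1 1 x)\<^sup>2" for x
    unfolding sq by (simp add: power_mult_distrib)
  then show ?thesis
    using integrable_hermite_fun1_sq[of 1] LBINT_hermite_fun1_sq[of 1]
    by (intro that[of "\<lambda>x. 1/2 * (hermite_fun1 1 x)\<^sup>2"]) (auto simp: 0)
next
  case (Suc m)
  have "hermite_deriv1 k x =
      sqrt ((real m + 1) / 2) * hermite_fun1 m x - sqrt ((real m + 2) / 2) * hermite_fun1 (Suc (Suc m)) x" for x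
    using DERIV_unique[OF has_real_derivative_hermite_fun1[of "Suc m" x] has_real_derivative_hermite_fun1_Suc[of m x]]
    by (simp add: hermite_deriv1_def Suc)
  moreover have "(a - b)\<^sup>2 \<le> 2 * a\<^sup>2 + 2 * b\<^sup>2" for a b :: real
    using sum_squares_ge_zero[of "a + b" 0] by (simp add: power2_eq_square algebra_simps)
  ultimately have "(hermite_deriv1 k x)\<^sup>2 \<le>
      2 * (sqrt ((real m + 1) / 2) * hermite_fun1 m x)\<^sup>2 + 2 * (sqrt ((real m + 2) / 2) * hermite_fun1 (Suc (Suc m)) x)\<^sup>2" for x
    by metis
  then have "(hermite_deriv1 k x)\<^sup>2 \<le>
      (real m + 1) * (hermite_fun1 m x)\<^sup>2 + (real m + 2) * (hermite_fun1 (Suc (Suc m)) x)\<^sup>2" for x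
    by (simp add: power_mult_distrib)
  then show ?thesis
    by (intro that[of "\<lambda>x. (real m + 1) * (hermite_fun1 m x)\<^sup>2 + (real m + 2) * (hermite_fun1 (Suc (Suc m)) x)\<^sup>2"])
      (auto simp: Suc LBINT_hermite_fun1_sq integrable_hermite_fun1_sq)
qed

text \<open>\<open>\<phi>\<^sub>k(x)\<^sup>2 = \<phi>\<^sub>k(0)\<^sup>2 + 2 \<integral>\<^sub>0\<^sup>x \<phi>\<^sub>k \<phi>\<^sub>k' \<le> 1 + \<integral> (\<phi>\<^sub>k\<^sup>2 + \<phi>\<^sub>k'\<^sup>2)\<close>.\<close>

lemma hermite_fun1_sq_le: "(hermite_fun1 k x)\<^sup>2 \<le> 2 * real k + 3"
proof -
  obtain g where g: "integrable lborel g" "\<And>x. (hermite_deriv1 k x)\<^sup>2 \<le> g x" "(LBINT x. g x) \<le> 2 * real k + 1"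
    using hermite_deriv1_sq[of k] by blast
  define D where "D = (\<lambda>x. 2 * hermite_fun1 k x * hermite_deriv1 k x)"
  define h where "h = (\<lambda>x. (hermite_fun1 k x)\<^sup>2 + g x)"
  have hint: "integrable lborel h" "(LBINT x. h x) \<le> 2 * real k + 2"
    using g by (auto simp: h_def integrable_hermite_fun1_sq LBINT_hermite_fun1_sq)
  have Dh: "\<bar>D x\<bar> \<le> h x" for x
  proof -
    have "2 * \<bar>a\<bar> * \<bar>b\<bar> \<le> a\<^sup>2 + b\<^sup>2" for a b :: real
      using sum_squares_bound[of "\<bar>a\<bar>" "\<bar>b\<bar>"] by simp
    from this[of "hermite_fun1 k x" "hermite_deriv1 k x"] g(2)[of x] show ?thesis
      unfolding D_def h_def abs_mult by simp
  qed
  have der: "((\<lambda>x. (hermite_fun1 k x)\<^sup>2) has_real_derivative D x) (at x)" for x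
    unfolding D_def hermite_deriv1_def
    by (rule derivative_eq_intros has_real_derivative_hermite_fun1)+ (auto simp: algebra_simps)
  have cont: "continuous_on S D" for S
    unfolding D_def hermite_deriv1_def by (intro continuous_intros)
  have *: "\<bar>(hermite_fun1 k b)\<^sup>2 - (hermite_fun1 k a)\<^sup>2\<bar> \<le> 2 * real k + 2" if "a \<le> b" for a b
  proof -
    have "(LBINT x. indicator {a..b} x *\<^sub>R D x) = (hermite_fun1 k b)\<^sup>2 - (hermite_fun1 k a)\<^sup>2"
      using der
      by (intro integral_FTC_atLeastAtMost that cont)
        (auto simp: has_real_derivative_iff_has_vector_derivative[symmetric] intro: has_field_derivative_at_within)
    moreover have "norm (LBINT x. indicator {a..b} x *\<^sub>R D x) \<le> (LBINT x. h x)"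
    proof (rule order_trans[OF integral_norm_bound integral_mono])
      show "integrable lborel (\<lambda>x. norm (indicator {a..b} x *\<^sub>R D x))"
        using borel_integrable_atLeastAtMost'[OF cont, of a b] unfolding set_integrable_def
        by (rule integrable_norm)
      show "norm (indicator {a..b} x *\<^sub>R D x) \<le> h x" for x
        using Dh[of x] by (auto simp: indicator_def)
    qed (rule hint)
    ultimately show ?thesis using hint by simp
  qed
  show ?thesis
    using *[of 0 x] *[of x 0] hermite_fun1_at_0[of k] by (cases "x \<ge> 0") auto
qed

lemma abs_hermite_fun1_le: "\<bar>hermite_fun1 k x\<bar> \<le> 2 * real k + 3"
proof -
  have "2 * real k + 3 \<le> (2 * real k + 3)\<^sup>2"
    by (rule self_le_power) auto
  then have "\<bar>hermite_fun1 k x\<bar>\<^sup>2 \<le> (2 * real k + 3)\<^sup>2"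
    using hermite_fun1_sq_le[of k x] by simp
  then show ?thesis
    by (rule power2_le_imp_le) simp
qed

text \<open>Both ladder coefficients are at most \<open>real k + 1\<close>. For \<open>k = 0\<close>
  the truncated \<open>k - 1\<close> is 0 and merely adds a nonnegative term to the bound.\<close>

lemma abs_x_hermite_fun1_le:
  "\<bar>x * hermite_fun1 k x\<bar> \<le> (real k + 1) * (\<bar>hermite_fun1 (Suc k) x\<bar> + \<bar>hermite_fun1 (k - 1) x\<bar>)"
proof (cases k)
  case 0
  have "sqrt (1/2) \<le> 1" by simp
  then have "sqrt (1/2) * \<bar>hermite_fun1 1 x\<bar> \<le> 1 * \<bar>hermite_fun1 1 x\<bar>"
    by (intro mult_right_mono) auto
  then show ?thesis
    by (simp add: 0 x_hermite_fun1_0 abs_mult)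
next
  case (Suc m)
  have s: "sqrt (a / 2) \<le> real m + 2" if "0 \<le> a" "a \<le> real m + 2" for a
  proof -
    have "real m + 2 \<le> (real m + 2)\<^sup>2"
      by (rule self_le_power) auto
    with that have "a / 2 \<le> (real m + 2)\<^sup>2"
      by linarith
    then show ?thesis by (intro real_le_lsqrt) auto
  qed
  have "\<bar>x * hermite_fun1 k x\<bar> \<le> \<bar>sqrt ((real m + 2) / 2) * hermite_fun1 (Suc (Suc m)) x\<bar>
      + \<bar>sqrt ((real m + 1) / 2) * hermite_fun1 m x\<bar>"
    unfolding Suc x_hermite_fun1_Suc by (rule abs_triangle_ineq)
  also have "\<dots> \<le> (real m + 2) * \<bar>hermite_fun1 (Suc (Suc m)) x\<bar> + (real m + 2) * \<bar>hermite_fun1 m x\<bar>"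
    unfolding abs_mult by (intro add_mono mult_right_mono) (auto intro!: s)
  finally show ?thesis
    by (simp add: Suc algebra_simps)
qed

text \<open>Two multiplications by \<open>x\<close>, each shifting the index by one at the cost of a
  factor linear in \<open>k\<close>, reduce \<open>x\<^sup>2\<close> times the function to the
  uniform bound at indices up to \<open>k + 2\<close>. The constants 56 and 7 add up to 63, rounded
  up to 100.\<close>

lemma hermite_fun1_decay: "\<bar>hermite_fun1 k x\<bar> \<le> 100 * (real k + 1) ^ 3 / (1 + x\<^sup>2)"
proof -
  define K where "K = real k + 1"
  have K: "K \<ge> 1" by (simp add: K_def)
  \<comment> \<open>\<open>2 * j + 3 \<le> 2 * k + 7 \<le> 7 * K\<close>.\<close>
  have b: "\<bar>hermite_fun1 j y\<bar> \<le> 7 * K" if "j \<le> k + 2" for j y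
    using abs_hermite_fun1_le[of j y] that unfolding K_def by simp
  have c: "\<bar>x * hermite_fun1 j x\<bar> \<le> 28 * K\<^sup>2" if "j \<le> k + 1" for j
  proof -
    have "\<bar>x * hermite_fun1 j x\<bar> \<le> (real j + 1) * (\<bar>hermite_fun1 (Suc j) x\<bar> + \<bar>hermite_fun1 (j - 1) x\<bar>)"
      by (rule abs_x_hermite_fun1_le)
    also have "\<dots> \<le> (2 * K) * (7 * K + 7 * K)"
      using that by (intro mult_mono add_mono b) (auto simp: K_def)
    finally show ?thesis by (simp add: power2_eq_square)
  qed
  have "\<bar>x * (x * hermite_fun1 k x)\<bar> = \<bar>x\<bar> * \<bar>x * hermite_fun1 k x\<bar>"
    by (simp add: abs_mult)
  also have "\<dots> \<le> \<bar>x\<bar> * ((real k + 1) * (\<bar>hermite_fun1 (Suc k) x\<bar> + \<bar>hermite_fun1 (k - 1) x\<bar>))"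
    by (intro mult_left_mono abs_x_hermite_fun1_le) auto
  also have "\<dots> = K * (\<bar>x * hermite_fun1 (Suc k) x\<bar> + \<bar>x * hermite_fun1 (k - 1) x\<bar>)"
    by (simp add: K_def abs_mult algebra_simps)
  also have "\<dots> \<le> K * (28 * K\<^sup>2 + 28 * K\<^sup>2)"
    using K by (intro mult_left_mono add_mono c) auto
  finally have "\<bar>x * (x * hermite_fun1 k x)\<bar> \<le> 56 * K ^ 3"
    by (simp add: power2_eq_square power3_eq_cube)
  moreover have "\<bar>hermite_fun1 k x\<bar> \<le> 7 * K ^ 3"
  proof -
    have "K * 1 \<le> K * K\<^sup>2" using K by (intro mult_left_mono) auto
    then show ?thesis using b[of k x] by (simp add: power2_eq_square power3_eq_cube)
  qed
  ultimately have "(1 + x\<^sup>2) * \<bar>hermite_fun1 k x\<bar> \<le> 100 * K ^ 3"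
    using K by (simp add: abs_mult algebra_simps power2_eq_square)
  then show ?thesis
    by (simp add: K_def field_simps add_pos_nonneg)
qed

subsection \<open>Tensor products on \<open>\<real>\<^sup>n\<close>\<close>

text \<open>Fubini: \<open>lborel\<close> on \<open>real ^ 'n\<close> is the image of the product
  measure indexed by \<open>Basis\<close>, and \<open>axis\<close> identifies \<open>Basis\<close>
  with the index type \<open>'n\<close>.\<close>

lemma
  fixes g :: "'n::finite \<Rightarrow> real \<Rightarrow> real"
  assumes int: "\<And>j. integrable lborel (g j)"
  shows integrable_prod_vec: "integrable lborel (\<lambda>x :: real ^ 'n. \<Prod>j\<in>UNIV. g j (x $ j))" (is "integrable _ ?f")
    and LBINT_prod_vec: "(LBINT x :: real ^ 'n. \<Prod>j\<in>UNIV. g j (x $ j)) = (\<Prod>j\<in>UNIV. LBINT y. g j y)"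
proof -
  interpret product_sigma_finite "\<lambda>_ :: real ^ 'n. lborel :: real measure"
    by unfold_locales
  define ax where "ax = (\<lambda>j :: 'n. axis j (1 :: real))"
  have inj: "inj ax"
    by (auto simp: ax_def inj_def axis_eq_axis)
  have Basis: "(Basis :: (real ^ 'n) set) = range ax"
    by (auto simp: Basis_vec_def ax_def)
  define h where "h b = g (inv ax b)" for b
  have h: "integrable lborel (h b)" for b
    unfolding h_def by (rule int)
  let ?S = "\<lambda>y :: real ^ 'n \<Rightarrow> real. \<Sum>b\<in>Basis. y b *\<^sub>R b"
  have S: "?S y $ j = y (ax j)" for y j
  proof -
    have "?S y $ j = ?S y \<bullet> ax j"
      by (simp add: ax_def inner_axis)
    also have "\<dots> = (\<Sum>b\<in>Basis. if b = ax j then y b else 0)"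
      unfolding inner_sum_left
      by (intro sum.cong) (auto simp: Basis inner_Basis ax_def inner_axis_axis axis_eq_axis)
    also have "\<dots> = y (ax j)"
      by (simp add: Basis)
    finally show ?thesis .
  qed
  have prod: "(\<Prod>j\<in>UNIV. g j (?S y $ j)) = (\<Prod>b\<in>Basis. h b (y b))" for y
  proof -
    have "(\<Prod>b\<in>Basis. h b (y b)) = (\<Prod>j\<in>UNIV. h (ax j) (y (ax j)))"
      unfolding Basis by (subst prod.reindex[OF inj]) (simp add: o_def)
    then show ?thesis
      by (simp only: S h_def inv_f_f[OF inj])
  qed
  have [measurable]: "g j \<in> borel_measurable borel" for j
    using int[of j] by auto
  have meas: "?f \<in> borel_measurable borel"
    by measurable
  have lb: "(lborel :: (real ^ 'n) measure) = distr (\<Pi>\<^sub>M b\<in>Basis. lborel) borel ?S"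
    by (rule lborel_eq)
  have S_meas: "?S \<in> (\<Pi>\<^sub>M b\<in>Basis. lborel) \<rightarrow>\<^sub>M borel"
    by measurable
  have ip: "integrable (\<Pi>\<^sub>M b\<in>Basis. lborel) (\<lambda>y. \<Prod>b\<in>Basis. h b (y b))"
    by (rule product_integrable_prod) (auto intro: h)
  show "integrable lborel ?f"
    unfolding lb by (subst integrable_distr_eq[OF S_meas meas]) (simp only: prod ip)
  have "(LBINT x. ?f x) = integral\<^sup>L (\<Pi>\<^sub>M b\<in>Basis. lborel) (\<lambda>y. ?f (?S y))"
    unfolding lb by (rule integral_distr[OF S_meas meas])
  also have "\<dots> = integral\<^sup>L (\<Pi>\<^sub>M b\<in>Basis. lborel) (\<lambda>y. \<Prod>b\<in>Basis. h b (y b))"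
    by (simp only: prod)
  also have "\<dots> = (\<Prod>b\<in>Basis. LBINT y. h b y)"
    by (rule product_integral_prod) (auto intro: h)
  also have "\<dots> = (\<Prod>j\<in>UNIV. LBINT y. g j y)"
    unfolding Basis by (subst prod.reindex[OF inj]) (simp add: h_def inv_f_f[OF inj])
  finally show "(LBINT x. ?f x) = (\<Prod>j\<in>UNIV. LBINT y. g j y)" .
qed

text \<open>The product of \<open>CARD('n)\<close> copies of an absolutely convergent series,
  multiplied out; the functions in \<open>PiE UNIV (\<lambda>_. UNIV)\<close> are all
  multi-indices.\<close>

lemma has_sum_prod_multiindex:
  fixes g :: "nat \<Rightarrow> real"
  assumes nn: "\<And>k. 0 \<le> g k" and g: "summable g"
  shows "((\<lambda>\<nu> :: 'n::finite \<Rightarrow> nat. \<Prod>j\<in>UNIV. g (\<nu> j)) has_sum (suminf g) ^ CARD('n)) UNIV"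
proof -
  have PiE: "PiE (UNIV :: 'n set) (\<lambda>_. UNIV :: nat set) = UNIV"
    by (auto simp: PiE_def)
  have "g summable_on UNIV"
    using g nn by (intro norm_summable_imp_summable_on) simp
  then have s: "Infinite_Sum.abs_summable_on g UNIV"
    using nn by simp
  have "Infinite_Set_Sum.abs_summable_on (\<lambda>\<nu> :: 'n \<Rightarrow> nat. \<Prod>j\<in>UNIV. g (\<nu> j)) (PiE UNIV (\<lambda>_. UNIV))"
    using s by (intro abs_summable_on_prod_PiE) (auto simp: abs_summable_equivalent[symmetric])
  then have "(\<lambda>\<nu> :: 'n \<Rightarrow> nat. \<Prod>j\<in>UNIV. g (\<nu> j)) summable_on UNIV"
    unfolding abs_summable_equivalent[symmetric] PiE by (rule abs_summable_summable)
  moreover have "infsum (\<lambda>\<nu> :: 'n \<Rightarrow> nat. \<Prod>j\<in>UNIV. g (\<nu> j)) (PiE UNIV (\<lambda>_. UNIV)) = (\<Prod>j\<in>(UNIV::'n set). infsum g UNIV)"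
    using s by (intro infsum_prod_PiE_abs) auto
  moreover have "infsum g UNIV = suminf g"
    using has_sum_imp_sums[OF has_sum_infsum[OF \<open>g summable_on UNIV\<close>]] by (simp add: sums_iff)
  ultimately show ?thesis
    by (simp add: PiE has_sum_iff)
qed

text \<open>Being integrable and at most 1, it satisfies
  \<open>weight x powr p \<le> weight x\<close> for all \<open>p \<ge> 1\<close>.\<close>

definition weight :: "real ^ 'n::finite \<Rightarrow> real" where
  "weight x = (\<Prod>j\<in>UNIV. 1 / (1 + (x $ j)\<^sup>2))"

lemma weight_bounds: "0 \<le> weight x" "weight x \<le> 1"
proof -
  have "1 / (1 + y\<^sup>2) \<le> 1 / 1" for y :: real
    by (rule divide_left_mono) (auto intro!: add_pos_nonneg mult_pos_pos)
  then show "0 \<le> weight x" "weight x \<le> 1"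
    by (auto simp: weight_def intro!: prod_nonneg prod_le_1)
qed

lemma integrable_weight: "integrable lborel weight"
proof -
  have "integrable lborel (\<lambda>y::real. 1 / (1 + y\<^sup>2))"
    using integrable_inverse_1_plus_square by (simp add: set_integrable_def inverse_eq_divide)
  then show ?thesis
    unfolding weight_def[abs_def] by (rule integrable_prod_vec)
qed

lemma borel_measurable_weight [measurable]: "weight \<in> borel_measurable borel"
  using integrable_weight by auto

text \<open>The added 1 keeps the constant below its own p-th power and, in the bound for the
  coefficients, absorbs the integral of \<open>norm (f x) powr p\<close> for \<open>f\<close> of
  norm at most 1.\<close>

definition weight_mass :: "'n::finite itself \<Rightarrow> real" where
  "weight_mass _ = 1 + (LBINT x :: real ^ 'n. weight x)"

lemma weight_mass_ge_1: "1 \<le> weight_mass TYPE('n::finite)"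
  by (simp add: weight_mass_def Bochner_Integration.integral_nonneg weight_bounds)

lemma weight_dominated_Lp:
  fixes h :: "real ^ 'n::finite \<Rightarrow> complex"
  assumes p: "1 \<le> p" and h[measurable]: "h \<in> borel_measurable borel"
    and c: "0 \<le> c" and le: "\<And>x. norm (h x) \<le> c * weight x"
  shows "h \<in> carr (Lp lborel p)" "nrm (Lp lborel p) h \<le> c * weight_mass TYPE('n)"
proof -
  have hp: "norm (h x) powr p \<le> c powr p * weight x" for x
  proof -
    have "norm (h x) powr p \<le> (c * weight x) powr p"
      using p by (intro powr_mono2 le) auto
    also have "\<dots> = c powr p * weight x powr p"
      using c weight_bounds[of x] by (simp add: powr_mult)
    also have "weight x powr p \<le> weight x powr 1"
      using p weight_bounds[of x] by (intro powr_mono') auto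
    finally show ?thesis using weight_bounds[of x] by (simp add: mult_left_mono)
  qed
  have int: "integrable lborel (\<lambda>x. norm (h x) powr p)"
  proof (rule Bochner_Integration.integrable_bound)
    show "integrable lborel (\<lambda>x :: real ^ 'n. c powr p * weight x)"
      by (simp add: integrable_weight)
    show "AE x in lborel. norm (norm (h x) powr p) \<le> norm (c powr p * weight x)"
      using hp by (simp add: abs_mult weight_bounds)
  qed measurable
  then show "h \<in> carr (Lp lborel p)"
    by (simp add: carr_Lp)
  have "(LBINT x. norm (h x) powr p) \<le> (LBINT x :: real ^ 'n. c powr p * weight x)"
    by (intro integral_mono int hp) (simp add: integrable_weight)
  also have "\<dots> = c powr p * (LBINT x :: real ^ 'n. weight x)"
    by simp
  also have "\<dots> \<le> c powr p * weight_mass TYPE('n) powr p"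
  proof (intro mult_left_mono)
    have "weight_mass TYPE('n) powr 1 \<le> weight_mass TYPE('n) powr p"
      using p weight_mass_ge_1[where ?'n = 'n] by (intro powr_mono) auto
    then show "(LBINT x :: real ^ 'n. weight x) \<le> weight_mass TYPE('n) powr p"
      using weight_mass_ge_1[where ?'n = 'n] by (simp add: weight_mass_def)
  qed simp
  also have "\<dots> = (c * weight_mass TYPE('n)) powr p"
    using c weight_mass_ge_1[where ?'n = 'n] by (simp add: powr_mult)
  finally show "nrm (Lp lborel p) h \<le> c * weight_mass TYPE('n)"
    using p c weight_mass_ge_1[where ?'n = 'n] by (simp add: nrm_Lp_le_iff)
qed

subsection \<open>Hermite functions and coefficients\<close>

definition hermite_bound :: "('n::finite \<Rightarrow> nat) \<Rightarrow> real" where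
  "hermite_bound \<nu> = (\<Prod>j\<in>UNIV. 100 * (real (\<nu> j) + 1) ^ 3)"

lemma hermite_bound_nonneg: "0 \<le> hermite_bound \<nu>"
  by (auto simp: hermite_bound_def intro: prod_nonneg)

lemma hermite_fun_decay: "\<bar>hermite_fun \<nu> x\<bar> \<le> hermite_bound \<nu> * weight x"
proof -
  have "\<bar>hermite_fun \<nu> x\<bar> = (\<Prod>j\<in>UNIV. \<bar>hermite_fun1 (\<nu> j) (x $ j)\<bar>)"
    by (simp add: hermite_fun_def abs_prod)
  also have "\<dots> \<le> (\<Prod>j\<in>UNIV. 100 * (real (\<nu> j) + 1) ^ 3 / (1 + (x $ j)\<^sup>2))"
    by (intro prod_mono conjI hermite_fun1_decay) auto
  also have "\<dots> = hermite_bound \<nu> * weight x"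
    by (simp add: hermite_bound_def weight_def prod.distrib[symmetric])
  finally show ?thesis .
qed

lemma borel_measurable_hermite_fun [measurable]: "hermite_fun \<nu> \<in> borel_measurable borel"
  unfolding hermite_fun_def[abs_def] by measurable

lemma hermite_fun_Lp:
  fixes \<nu> :: "'n::finite \<Rightarrow> nat"
  assumes "1 \<le> p"
  shows "(\<lambda>x. of_real (hermite_fun \<nu> x)) \<in> carr (Lp lborel p)"
    "nrm (Lp lborel p) (\<lambda>x. of_real (hermite_fun \<nu> x)) \<le> hermite_bound \<nu> * weight_mass TYPE('n)"
  using weight_dominated_Lp[OF assms, of "\<lambda>x. of_real (hermite_fun \<nu> x)" "hermite_bound \<nu>"]
    hermite_fun_decay[of \<nu>] hermite_bound_nonneg[of \<nu>] by simp_all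

lemma hermite_coeff_self: "hermite_coeff (\<lambda>x. of_real (hermite_fun \<nu> x)) \<nu> = 1"
proof -
  have "hermite_coeff (\<lambda>x. of_real (hermite_fun \<nu> x)) \<nu> = of_real (LBINT x. (hermite_fun \<nu> x)\<^sup>2)"
    unfolding hermite_coeff_def by (simp add: power2_eq_square flip: of_real_mult)
  also have "(LBINT x. (hermite_fun \<nu> x)\<^sup>2) = (LBINT x. \<Prod>j\<in>UNIV. (hermite_fun1 (\<nu> j) (x $ j))\<^sup>2)"
    by (simp add: hermite_fun_def prod_power_distrib)
  also have "\<dots> = 1"
    by (subst LBINT_prod_vec) (simp_all add: integrable_hermite_fun1_sq LBINT_hermite_fun1_sq)
  finally show ?thesis by simp
qed

lemma (in seminormed_fun_space) dualI:
  assumes add: "\<And>f g. f \<in> carr E \<Longrightarrow> g \<in> carr E \<Longrightarrow> e (\<lambda>x. f x + g x) = e f + e g"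
    and scale: "\<And>c f. f \<in> carr E \<Longrightarrow> e (\<lambda>x. c * f x) = c * e f"
    and bound: "\<And>f. f \<in> carr E \<Longrightarrow> nrm E f \<le> 1 \<Longrightarrow> norm (e f) \<le> C"
  shows "e \<in> dual E"
proof -
  have C: "0 \<le> C"
    using bound[OF carr_zero] by (simp add: nrm_zero order_trans[OF norm_ge_zero])
  have "norm (e f) \<le> C * nrm E f" if f: "f \<in> carr E" for f
  proof (rule field_le_epsilon)
    fix \<epsilon> :: real assume "\<epsilon> > 0"
    \<comment> \<open>\<open>nrm E f\<close> may be 0, so \<open>f\<close> is divided by a slightly
      larger positive number; the surplus costs
      \<open>C * (\<epsilon> / (C + 1)) \<le> \<epsilon>\<close>.\<close>
    define \<delta> where "\<delta> = nrm E f + \<epsilon> / (C + 1)"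
    have d: "\<delta> > 0" "nrm E f \<le> \<delta>"
      using C \<open>\<epsilon> > 0\<close> nrm_nonneg[OF f] by (auto simp: \<delta>_def add_nonneg_pos)
    have "nrm E (\<lambda>x. of_real (1 / \<delta>) * f x) \<le> 1"
      using d by (subst nrm_scale[OF f]) (simp add: norm_divide)
    from bound[OF carr_scale[OF f] this] have "norm (e f) \<le> C * \<delta>"
      using d by (subst (asm) scale[OF f]) (simp add: norm_mult norm_divide field_simps)
    also have "C * (\<epsilon> / (C + 1)) \<le> \<epsilon>"
      using C \<open>\<epsilon> > 0\<close> by (simp add: field_simps)
    then have "C * \<delta> \<le> C * nrm E f + \<epsilon>"
      by (simp add: \<delta>_def distrib_left)
    finally show "norm (e f) \<le> C * nrm E f + \<epsilon>" .
  qed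
  then show ?thesis
    using add scale unfolding dual_def by blast
qed

text \<open>A crude form of Young's inequality, uniform in \<open>p\<close> and valid at
  \<open>p = 1\<close>, where the conjugate exponent is infinite.\<close>

lemma mult_le_powr_add:
  fixes a w p :: real
  assumes "1 \<le> p" "0 \<le> a" "0 \<le> w" "w \<le> 1"
  shows "a * w \<le> a powr p + w"
proof (cases "a \<le> 1")
  case True
  then have "a * w \<le> 1 * w"
    using assms by (intro mult_right_mono) auto
  then show ?thesis using powr_ge_zero[of a p] by linarith
next
  case False
  then have "a powr 1 \<le> a powr p"
    using assms by (intro powr_mono) auto
  moreover have "a * w \<le> a * 1"
    using assms by (intro mult_left_mono) auto
  ultimately show ?thesis using assms by simp
qed

text \<open>The majorant \<open>norm (f x) powr p + weight x\<close> is not homogeneous in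
  \<open>f\<close>, hence the restriction to norm at most 1; \<open>dualI\<close> and
  \<open>dual_norm_le\<close> ask for no more.\<close>

lemma
  fixes f :: "real ^ 'n::finite \<Rightarrow> complex" and p :: real
  assumes p: "1 \<le> p" and f: "f \<in> carr (Lp lborel p)"
  shows integrable_hermite_coeff: "integrable lborel (\<lambda>x. f x * of_real (hermite_fun \<nu> x))"
    and norm_hermite_coeff_le: "nrm (Lp lborel p) f \<le> 1 \<Longrightarrow>
      norm (hermite_coeff f \<nu>) \<le> hermite_bound \<nu> * weight_mass TYPE('n)"
proof -
  have [measurable]: "f \<in> borel_measurable borel"
    using f by (simp add: carr_Lp)
  let ?g = "\<lambda>x. hermite_bound \<nu> * (norm (f x) powr p + weight x)"
  have le: "norm (f x * of_real (hermite_fun \<nu> x)) \<le> ?g x" for x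
  proof -
    have "norm (f x * of_real (hermite_fun \<nu> x)) = norm (f x) * \<bar>hermite_fun \<nu> x\<bar>"
      by (simp add: norm_mult)
    also have "\<dots> \<le> norm (f x) * (hermite_bound \<nu> * weight x)"
      by (intro mult_left_mono hermite_fun_decay) auto
    also have "\<dots> = hermite_bound \<nu> * (norm (f x) * weight x)"
      by simp
    also have "\<dots> \<le> ?g x"
      using p by (intro mult_left_mono mult_le_powr_add hermite_bound_nonneg weight_bounds) auto
    finally show ?thesis .
  qed
  have fi: "integrable lborel (\<lambda>x. norm (f x) powr p)"
    using f by (simp add: carr_Lp)
  have gi: "integrable lborel ?g"
    by (intro integrable_mult_right Bochner_Integration.integrable_add fi integrable_weight)
  show int: "integrable lborel (\<lambda>x. f x * of_real (hermite_fun \<nu> x))"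
  proof (rule Bochner_Integration.integrable_bound[OF gi])
    show "AE x in lborel. norm (f x * of_real (hermite_fun \<nu> x)) \<le> norm (?g x)"
      using le order_trans[OF le abs_ge_self] by simp
  qed measurable
  assume "nrm (Lp lborel p) f \<le> 1"
  then have f1: "(LBINT x. norm (f x) powr p) \<le> 1"
    using p by (simp add: nrm_Lp_le_iff)
  have "norm (hermite_coeff f \<nu>) \<le> (LBINT x. ?g x)"
    unfolding hermite_coeff_def
    by (rule order_trans[OF integral_norm_bound integral_mono[OF integrable_norm[OF int] gi le]])
  also have "\<dots> = hermite_bound \<nu> * ((LBINT x. norm (f x) powr p) + (LBINT x :: real ^ 'n. weight x))"
    using fi integrable_weight[where ?'a = 'n] by simp
  also have "\<dots> \<le> hermite_bound \<nu> * weight_mass TYPE('n)"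
    using f1 by (intro mult_left_mono hermite_bound_nonneg) (simp add: weight_mass_def)
  finally show "norm (hermite_coeff f \<nu>) \<le> hermite_bound \<nu> * weight_mass TYPE('n)" .
qed

lemma hermite_coeff_dual:
  fixes \<nu> :: "'n::finite \<Rightarrow> nat"
  assumes p: "1 \<le> p"
  shows "(\<lambda>f. c * hermite_coeff f \<nu>) \<in> dual (Lp lborel p)"
    "dual_norm (Lp lborel p) (\<lambda>f. c * hermite_coeff f \<nu>) \<le> norm c * (hermite_bound \<nu> * weight_mass TYPE('n))"
proof -
  interpret seminormed_fun_space "Lp lborel p" by (rule seminormed_Lp[OF p])
  have bound: "norm (c * hermite_coeff f \<nu>) \<le> norm c * (hermite_bound \<nu> * weight_mass TYPE('n))"
    if "f \<in> carr (Lp lborel p)" "nrm (Lp lborel p) f \<le> 1" for f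
    using norm_hermite_coeff_le[OF p that] by (simp add: norm_mult mult_left_mono)
  show "(\<lambda>f. c * hermite_coeff f \<nu>) \<in> dual (Lp lborel p)"
  proof (rule dualI[OF _ _ bound])
    fix f g :: "real ^ 'n \<Rightarrow> complex" and d :: complex
    assume f: "f \<in> carr (Lp lborel p)"
    show "c * hermite_coeff (\<lambda>x. d * f x) \<nu> = d * (c * hermite_coeff f \<nu>)"
      unfolding hermite_coeff_def by (simp add: mult.assoc mult.left_commute)
    assume g: "g \<in> carr (Lp lborel p)"
    show "c * hermite_coeff (\<lambda>x. f x + g x) \<nu> = c * hermite_coeff f \<nu> + c * hermite_coeff g \<nu>"
      unfolding hermite_coeff_def
      using integrable_hermite_coeff[OF p f, of \<nu>] integrable_hermite_coeff[OF p g, of \<nu>]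
      by (simp add: distrib_left distrib_right)
  qed
  show "dual_norm (Lp lborel p) (\<lambda>f. c * hermite_coeff f \<nu>) \<le> norm c * (hermite_bound \<nu> * weight_mass TYPE('n))"
    by (rule dual_norm_le[OF bound])
qed

subsection \<open>The semigroup as a nuclear series\<close>

definition hermite_eigenvalue :: "real \<Rightarrow> ('n::finite \<Rightarrow> nat) \<Rightarrow> real" where
  "hermite_eigenvalue t \<nu> = exp (- t * (2 * real (mi_abs \<nu>) + real CARD('n)))"

lemma hermite_eigenvalue_prod: "hermite_eigenvalue t \<nu> = (\<Prod>j\<in>UNIV. exp (- t * (2 * real (\<nu> j) + 1)))"
proof -
  have "(\<Sum>j\<in>UNIV. - t * (2 * real (\<nu> j) + 1)) = - t * (\<Sum>j\<in>UNIV. 2 * real (\<nu> j) + 1)"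
    by (rule sum_distrib_left[symmetric])
  also have "(\<Sum>j\<in>UNIV. 2 * real (\<nu> j) + 1) = 2 * real (mi_abs \<nu>) + real CARD('a)"
    by (simp add: mi_abs_def sum.distrib sum_distrib_left)
  finally show ?thesis
    by (simp only: hermite_eigenvalue_def exp_sum[OF finite, symmetric])
qed

lemma hermite_eigenvalue_pos: "0 < hermite_eigenvalue t \<nu>"
  by (simp add: hermite_eigenvalue_def)

text \<open>The polynomial is squared because the functional and the vector each contribute a factor
  of \<open>hermite_bound\<close>; exponential decay beats it, so comparison with
  \<open>1 / real k ^ 2\<close> suffices.\<close>

lemma summable_hermite_factor:
  fixes t r :: real
  assumes "t > 0" "r > 0"
  shows "summable (\<lambda>k. (exp (- t * (2 * real k + 1)) * (100 * (real k + 1) ^ 3)\<^sup>2) powr r)"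
proof (rule summable_comparison_test_bigo)
  show "summable (\<lambda>k. norm (1 / real k ^ 2))"
    using inverse_power_summable[of 2] by (simp add: inverse_eq_divide)
  show "(\<lambda>k. (exp (- t * (2 * real k + 1)) * (100 * (real k + 1) ^ 3)\<^sup>2) powr r) \<in> O(\<lambda>k. 1 / real k ^ 2)"
    using assms by real_asymp
qed

text \<open>Each term factors over the coordinates. Exponent \<open>r\<close> with
  \<open>K = (weight_mass TYPE('n))\<^sup>2\<close> serves the nuclear norms, exponent 1 with a
  multiple of \<open>nrm (Lp lborel p) f\<close> the convergence of the expansion.\<close>

lemma summable_on_hermite_terms:
  fixes t r K :: real
  assumes "t > 0" "r > 0" "0 \<le> K"
  shows "(\<lambda>\<nu> :: 'n::finite \<Rightarrow> nat. (hermite_eigenvalue t \<nu> * (hermite_bound \<nu>)\<^sup>2 * K) powr r) summable_on UNIV"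
proof -
  define g where "g k = (exp (- t * (2 * real k + 1)) * (100 * (real k + 1) ^ 3)\<^sup>2) powr r" for k
  have "(hermite_eigenvalue t \<nu> * (hermite_bound \<nu>)\<^sup>2 * K) powr r = (\<Prod>j\<in>UNIV. g (\<nu> j)) * K powr r" for \<nu> :: "'n \<Rightarrow> nat"
  proof -
    have "hermite_eigenvalue t \<nu> * (hermite_bound \<nu>)\<^sup>2 =
        (\<Prod>j\<in>UNIV. exp (- t * (2 * real (\<nu> j) + 1)) * (100 * (real (\<nu> j) + 1) ^ 3)\<^sup>2)"
      by (simp only: hermite_eigenvalue_prod hermite_bound_def prod_power_distrib prod.distrib[symmetric])
    also have "\<dots> powr r = (\<Prod>j\<in>UNIV. g (\<nu> j))"
      unfolding g_def by (rule prod_powr_distrib)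
    finally show ?thesis by (simp only: powr_mult)
  qed
  moreover have "(\<lambda>\<nu> :: 'n \<Rightarrow> nat. (\<Prod>j\<in>UNIV. g (\<nu> j))) summable_on UNIV"
    using has_sum_imp_summable[OF has_sum_prod_multiindex[of g]] summable_hermite_factor[OF assms(1,2)]
    unfolding g_def by simp
  ultimately show ?thesis
    by (simp add: summable_on_cmult_left)
qed

text \<open>Each coordinate contributes the geometric series
  \<open>exp (- t) / (1 - exp (- 2 * t))\<close>, which equals
  \<open>1 / (exp t - exp (- t))\<close>.\<close>

lemma hermite_eigenvalue_has_sum:
  assumes "t > 0"
  shows "((hermite_eigenvalue t :: ('n::finite \<Rightarrow> nat) \<Rightarrow> real) has_sum
    (exp t - exp (- t)) powi (- int CARD('n))) UNIV"
proof -
  have q: "norm (exp (- 2 * t)) < 1" using assms by simp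
  have "(\<lambda>k. exp (- t) * exp (- 2 * t) ^ k) sums (exp (- t) * (1 / (1 - exp (- 2 * t))))"
    by (intro sums_mult geometric_sums q)
  moreover have "exp (- t) * exp (- 2 * t) ^ k = exp (- t * (2 * real k + 1))" for k
    by (simp add: exp_of_nat_mult[symmetric] mult_exp_exp algebra_simps)
  moreover have "exp (- t) * (1 / (1 - exp (- 2 * t))) = inverse (exp t - exp (- t))"
  proof -
    have "1 - exp (- 2 * t) = exp (- t) * (exp t - exp (- t))"
      by (simp add: right_diff_distrib mult_exp_exp)
    then show ?thesis by (simp add: inverse_eq_divide)
  qed
  ultimately have s: "(\<lambda>k. exp (- t * (2 * real k + 1))) sums inverse (exp t - exp (- t))"
    by simp
  have "((\<lambda>\<nu> :: 'n \<Rightarrow> nat. \<Prod>j\<in>UNIV. exp (- t * (2 * real (\<nu> j) + 1))) has_sum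
      (suminf (\<lambda>k. exp (- t * (2 * real k + 1)))) ^ CARD('n)) UNIV"
    by (rule has_sum_prod_multiindex) (use s in \<open>auto simp: sums_iff\<close>)
  then show ?thesis
    using s by (simp add: hermite_eigenvalue_prod[abs_def] sums_iff power_int_minus power_inverse)
qed

section \<open>Enumeration of multi-indices and grouping by degree\<close>

lemma infinite_multiindices: "infinite (UNIV :: ('n::finite \<Rightarrow> nat) set)"
proof -
  have "inj (\<lambda>k :: nat. \<lambda>_ :: 'n. k)" by (auto simp: inj_def fun_eq_iff)
  then show ?thesis using finite_imageD[of "\<lambda>k :: nat. \<lambda>_ :: 'n. k" UNIV] finite_subset
    by (metis infinite_UNIV_nat top_greatest)
qed

text \<open>Nuclear representations are indexed by \<open>nat\<close>. An arbitrary enumeration will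
  do, since the series involved converge unconditionally.\<close>

definition multiindex :: "nat \<Rightarrow> 'n::finite \<Rightarrow> nat" where
  "multiindex = from_nat_into UNIV"

lemma bij_multiindex: "bij_betw (multiindex :: nat \<Rightarrow> 'n::finite \<Rightarrow> nat) UNIV UNIV"
  unfolding multiindex_def by (intro bij_betw_from_nat_into infinite_multiindices) auto

lemma has_sum_multiindex_sums:
  fixes F :: "('n::finite \<Rightarrow> nat) \<Rightarrow> 'a::banach"
  assumes "(F has_sum S) UNIV"
  shows "(\<lambda>i. F (multiindex i)) sums S"
  using assms has_sum_reindex_bij_betw[OF bij_multiindex, of F S] has_sum_imp_sums by blast

lemma mi_abs_fibre_finite: "finite {\<nu> :: 'n::finite \<Rightarrow> nat. mi_abs \<nu> = l}"
proof (rule finite_subset)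
  have "\<nu> j \<le> mi_abs \<nu>" for \<nu> :: "'n \<Rightarrow> nat" and j
    unfolding mi_abs_def by (rule member_le_sum) auto
  then show "{\<nu> :: 'n \<Rightarrow> nat. mi_abs \<nu> = l} \<subseteq> PiE UNIV (\<lambda>_. {..l})" by auto
qed (intro finite_PiE; simp)

text \<open>Unconditional convergence permits grouping into the finite sets of fixed degree, which
  is how \<open>hermite_semigroup\<close> arranges its series.\<close>

lemma has_sum_fibres_sums:
  fixes F :: "('n::finite \<Rightarrow> nat) \<Rightarrow> 'a::banach"
  assumes "(F has_sum S) UNIV"
  shows "(\<lambda>l. \<Sum>\<nu>\<in>{\<nu>. mi_abs \<nu> = l}. F \<nu>) sums S"
proof -
  have "bij_betw snd (Sigma UNIV (\<lambda>l. {\<nu> :: 'n \<Rightarrow> nat. mi_abs \<nu> = l})) UNIV"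
    by (rule bij_betw_byWitness[where f' = "\<lambda>\<nu>. (mi_abs \<nu>, \<nu>)"]) auto
  then have "((\<lambda>x. F (snd x)) has_sum S) (Sigma UNIV (\<lambda>l. {\<nu> :: 'n \<Rightarrow> nat. mi_abs \<nu> = l}))"
    using assms by (simp add: has_sum_reindex_bij_betw)
  then have "((\<lambda>l. \<Sum>\<nu>\<in>{\<nu>. mi_abs \<nu> = l}. F \<nu>) has_sum S) UNIV"
    by (rule has_sum_SigmaD) (simp add: mi_abs_fibre_finite has_sum_finite)
  then show ?thesis by (rule has_sum_imp_sums)
qed

lemma hermite_semigroup_cong:
  assumes "\<And>\<nu>. hermite_coeff f \<nu> = hermite_coeff g \<nu>"
  shows "hermite_semigroup t f = hermite_semigroup t g"
  unfolding hermite_semigroup_def[abs_def] hermite_proj_def assms ..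

section \<open>Convergence of the Hermite expansion, pointwise and in \<open>Lp\<close>\<close>

definition hermite_term :: "real \<Rightarrow> (real ^ 'n::finite \<Rightarrow> complex) \<Rightarrow> nat \<Rightarrow> real ^ 'n \<Rightarrow> complex" where
  "hermite_term t f i x = of_real (hermite_eigenvalue t (multiindex i :: 'n \<Rightarrow> nat)) * hermite_coeff f (multiindex i)
     * of_real (hermite_fun (multiindex i) x)"

definition hermite_majorant :: "real \<Rightarrow> real \<Rightarrow> (real ^ 'n::finite \<Rightarrow> complex) \<Rightarrow> nat \<Rightarrow> real" where
  "hermite_majorant t p f i = hermite_eigenvalue t (multiindex i :: 'n \<Rightarrow> nat) * (hermite_bound (multiindex i :: 'n \<Rightarrow> nat))\<^sup>2
     * (weight_mass TYPE('n) * nrm (Lp lborel p) f)"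

context
  fixes t p :: real and f :: "real ^ 'n::finite \<Rightarrow> complex"
  assumes t: "t > 0" and p: "1 \<le> p" and f: "f \<in> carr (Lp lborel p)"
begin

lemma norm_hermite_coeff_le_nrm: "norm (hermite_coeff f \<nu>) \<le> hermite_bound \<nu> * weight_mass TYPE('n) * nrm (Lp lborel p) f"
proof -
  interpret seminormed_fun_space "Lp lborel p :: (real ^ 'n) fun_space" by (rule seminormed_Lp[OF p])
  have "norm (1 * hermite_coeff f \<nu>) \<le> dual_norm (Lp lborel p) (\<lambda>f. 1 * hermite_coeff f \<nu>) * nrm (Lp lborel p) f"
    by (rule dual_bound[OF hermite_coeff_dual(1)[OF p] f])
  also have "\<dots> \<le> norm (1 :: complex) * (hermite_bound \<nu> * weight_mass TYPE('n)) * nrm (Lp lborel p) f"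
    by (intro mult_right_mono hermite_coeff_dual(2) p nrm_Lp_nonneg)
  finally show ?thesis by simp
qed

lemma norm_term_le:
  "norm (of_real (hermite_eigenvalue t \<nu>) * hermite_coeff f \<nu> * of_real (hermite_fun \<nu> x)) \<le>
     hermite_eigenvalue t \<nu> * (hermite_bound \<nu>)\<^sup>2 * (weight_mass TYPE('n) * nrm (Lp lborel p) f) * weight x"
proof -
  have "norm (of_real (hermite_eigenvalue t \<nu>) * hermite_coeff f \<nu> * of_real (hermite_fun \<nu> x)) =
      hermite_eigenvalue t \<nu> * norm (hermite_coeff f \<nu>) * \<bar>hermite_fun \<nu> x\<bar>"
    using hermite_eigenvalue_pos[of t \<nu>] by (simp add: norm_mult)
  also have "\<dots> \<le> hermite_eigenvalue t \<nu> * (hermite_bound \<nu> * weight_mass TYPE('n) * nrm (Lp lborel p) f) * (hermite_bound \<nu> * weight x)"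
  proof (rule mult_mono[OF mult_left_mono[OF norm_hermite_coeff_le_nrm] hermite_fun_decay])
    show "0 \<le> hermite_eigenvalue t \<nu>"
      by (rule less_imp_le[OF hermite_eigenvalue_pos])
    then show "0 \<le> hermite_eigenvalue t \<nu> * (hermite_bound \<nu> * weight_mass TYPE('n) * nrm (Lp lborel p) f)"
      by (rule mult_nonneg_nonneg[OF _ order_trans[OF norm_ge_zero norm_hermite_coeff_le_nrm]])
  qed simp
  finally show ?thesis by (simp add: power2_eq_square mult_ac)
qed

lemma summable_on_majorant:
  "(\<lambda>\<nu> :: 'n \<Rightarrow> nat. hermite_eigenvalue t \<nu> * (hermite_bound \<nu>)\<^sup>2 * (weight_mass TYPE('n) * nrm (Lp lborel p) f)) summable_on UNIV"
proof -
  let ?h = "\<lambda>\<nu> :: 'n \<Rightarrow> nat. hermite_eigenvalue t \<nu> * (hermite_bound \<nu>)\<^sup>2 * (weight_mass TYPE('n) * nrm (Lp lborel p) f)"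
  have nn: "0 \<le> weight_mass TYPE('n) * nrm (Lp lborel p) f"
    using weight_mass_ge_1[where ?'n = 'n] by (simp add: nrm_Lp_nonneg)
  then have "0 \<le> ?h \<nu>" for \<nu>
    by (intro mult_nonneg_nonneg[OF _ nn] mult_nonneg_nonneg less_imp_le[OF hermite_eigenvalue_pos] zero_le_power2)
  then have "?h \<nu> powr 1 = ?h \<nu>" for \<nu>
    by (simp only: powr_one abs_of_nonneg)
  with summable_on_hermite_terms[OF t zero_less_one nn, where ?'n = 'n] show ?thesis
    by (simp only:)
qed

lemma summable_majorant: "summable (hermite_majorant t p f)"
  unfolding hermite_majorant_def[abs_def]
  using has_sum_multiindex_sums[OF has_sum_infsum[OF summable_on_majorant]] by (auto simp: sums_iff)

lemma majorant_nonneg: "0 \<le> hermite_majorant t p f i"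
  unfolding hermite_majorant_def
  using weight_mass_ge_1[where ?'n = 'n]
  by (intro mult_nonneg_nonneg less_imp_le[OF hermite_eigenvalue_pos] zero_le_power2 nrm_Lp_nonneg) simp

lemma norm_hermite_term_le: "norm (hermite_term t f i x) \<le> hermite_majorant t p f i * weight x"
  unfolding hermite_term_def hermite_majorant_def by (rule norm_term_le)

text \<open>The expansion converges absolutely at each point, so summing by degree and summing along
  the enumeration give the same value; in particular the \<open>suminf\<close> in
  \<open>hermite_semigroup\<close> is a genuine sum.\<close>

lemma hermite_term_sums: "(\<lambda>i. hermite_term t f i x) sums hermite_semigroup t f x"
proof -
  define F where "F \<nu> = of_real (hermite_eigenvalue t \<nu>) * hermite_coeff f \<nu> * of_real (hermite_fun \<nu> x)" for \<nu>
  have "(\<lambda>\<nu>. norm (F \<nu>)) summable_on UNIV"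
    unfolding F_def
    by (rule summable_on_comparison_test[OF summable_on_cmult_left[OF summable_on_majorant, of "weight x"]])
      (rule norm_term_le norm_ge_zero)+
  then have F: "(F has_sum infsum F UNIV) UNIV"
    by (rule has_sum_infsum[OF abs_summable_summable])
  have "(\<Sum>\<nu>\<in>{\<nu>. mi_abs \<nu> = l}. F \<nu>) = of_real (exp (- t * (2 * real l + real CARD('n)))) * hermite_proj l f x" for l
    unfolding hermite_proj_def sum_distrib_left
    by (intro sum.cong) (auto simp: F_def hermite_eigenvalue_def mult.assoc)
  with has_sum_fibres_sums[OF F]
  have "(\<lambda>l. of_real (exp (- t * (2 * real l + real CARD('n)))) * hermite_proj l f x) sums infsum F UNIV"
    by (simp only:)
  then have "hermite_semigroup t f x = infsum F UNIV"
    unfolding hermite_semigroup_def by (rule sums_unique[symmetric])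
  moreover have "(\<lambda>i. hermite_term t f i x) sums infsum F UNIV"
    using has_sum_multiindex_sums[OF F] by (simp only: F_def hermite_term_def)
  ultimately show ?thesis by (simp only:)
qed

lemma hermite_term_measurable [measurable]: "hermite_term t f i \<in> borel_measurable borel"
  unfolding hermite_term_def[abs_def] by measurable

lemma hermite_semigroup_measurable [measurable]: "hermite_semigroup t f \<in> borel_measurable borel"
proof -
  have "hermite_semigroup t f = (\<lambda>x. \<Sum>i. hermite_term t f i x)"
    using hermite_term_sums by (auto simp: sums_iff)
  then show ?thesis by simp
qed

text \<open>All dependence on \<open>x\<close> sits in the factor \<open>weight x\<close>, so that
  \<open>weight_dominated_Lp\<close> turns the pointwise tail bound directly into a bound of the
  norm.\<close>

lemma hermite_remainder:
  "norm (hermite_semigroup t f x - (\<Sum>i<N. hermite_term t f i x)) \<le> (\<Sum>i. hermite_majorant t p f (i + N)) * weight x"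
proof -
  have s: "summable (\<lambda>i. hermite_majorant t p f (i + N))"
    using summable_majorant by (simp add: summable_iff_shift)
  have "hermite_semigroup t f x - (\<Sum>i<N. hermite_term t f i x) = (\<Sum>i. hermite_term t f (i + N) x)"
    using hermite_term_sums[of x] suminf_minus_initial_segment[of "\<lambda>i. hermite_term t f i x" N]
    by (simp add: sums_iff)
  also have "norm \<dots> \<le> (\<Sum>i. hermite_majorant t p f (i + N) * weight x)"
    by (rule norm_suminf_le[OF norm_hermite_term_le summable_mult2[OF s]])
  also have "\<dots> = (\<Sum>i. hermite_majorant t p f (i + N)) * weight x"
    by (rule suminf_mult2[OF s, symmetric])
  finally show ?thesis .
qed

lemma hermite_tail_nonneg: "0 \<le> (\<Sum>i. hermite_majorant t p f (i + N))"
  using summable_majorant majorant_nonneg by (intro suminf_nonneg) (simp_all add: summable_iff_shift)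

text \<open>At \<open>N = 0\<close> the partial sum is empty and the remainder is the whole
  function.\<close>

lemma hermite_semigroup_Lp: "hermite_semigroup t f \<in> carr (Lp lborel p)"
  by (rule weight_dominated_Lp[OF p _ hermite_tail_nonneg[of 0]]) (use hermite_remainder[of _ 0] in auto)

lemma nrm_hermite_remainder_tendsto:
  "(\<lambda>N. nrm (Lp lborel p) (\<lambda>x. hermite_semigroup t f x - (\<Sum>i<N. hermite_term t f i x))) \<longlonglongrightarrow> 0"
proof (rule Lim_null_comparison[OF always_eventually])
  show "\<forall>N. norm (nrm (Lp lborel p) (\<lambda>x. hermite_semigroup t f x - (\<Sum>i<N. hermite_term t f i x)))
      \<le> (\<Sum>i. hermite_majorant t p f (i + N)) * weight_mass TYPE('n)"
  proof
    fix N
    have "nrm (Lp lborel p) (\<lambda>x. hermite_semigroup t f x - (\<Sum>i<N. hermite_term t f i x))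
      \<le> (\<Sum>i. hermite_majorant t p f (i + N)) * weight_mass TYPE('n)"
      by (rule weight_dominated_Lp(2)[OF p _ hermite_tail_nonneg hermite_remainder]) measurable
    then show "norm (nrm (Lp lborel p) (\<lambda>x. hermite_semigroup t f x - (\<Sum>i<N. hermite_term t f i x)))
      \<le> (\<Sum>i. hermite_majorant t p f (i + N)) * weight_mass TYPE('n)"
      by (simp add: nrm_Lp_nonneg)
  qed
  have "(\<lambda>N. \<Sum>i. hermite_majorant t p f (i + N)) = (\<lambda>N. suminf (hermite_majorant t p f) - (\<Sum>i<N. hermite_majorant t p f i))"
    by (rule ext) (rule suminf_minus_initial_segment[OF summable_majorant])
  moreover have "(\<lambda>N. suminf (hermite_majorant t p f) - (\<Sum>i<N. hermite_majorant t p f i)) \<longlonglongrightarrow> suminf (hermite_majorant t p f) - suminf (hermite_majorant t p f)"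
    by (intro tendsto_intros summable_LIMSEQ summable_majorant)
  ultimately have "(\<lambda>N. \<Sum>i. hermite_majorant t p f (i + N)) \<longlonglongrightarrow> 0" by simp
  then show "(\<lambda>N. (\<Sum>i. hermite_majorant t p f (i + N)) * weight_mass TYPE('n)) \<longlonglongrightarrow> 0"
    by (rule tendsto_mult_left_zero)
qed

end

text \<open>Bounded functionals ignore null vectors, so equal vectors have the same coefficients and
  the same image at every point. Additivity and homogeneity hold pointwise too, by comparing the
  convergent expansions term by term.\<close>

lemma linear_operator_hermite_semigroup:
  assumes t: "t > 0" and p: "1 \<le> p"
  shows "linear_operator (Lp lborel p) (Lp lborel p)
    (hermite_semigroup t :: (real ^ 'n::finite \<Rightarrow> complex) \<Rightarrow> _)"
proof -
  interpret seminormed_fun_space "Lp lborel p :: (real ^ 'n) fun_space" by (rule seminormed_Lp[OF p])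
  have coeff: "(\<lambda>f. hermite_coeff f \<nu>) \<in> dual (Lp lborel p)" for \<nu> :: "'n \<Rightarrow> nat"
    using hermite_coeff_dual(1)[OF p, of 1 \<nu>] by simp
  have same: "same_vector (Lp lborel p) h h" for h :: "real ^ 'n \<Rightarrow> complex"
    by (simp add: same_vector_def nrm_zero)
  have cong: "hermite_semigroup t f = hermite_semigroup t g"
    if fg: "f \<in> carr (Lp lborel p)" "g \<in> carr (Lp lborel p)" "same_vector (Lp lborel p) f g"
    for f g :: "real ^ 'n \<Rightarrow> complex"
  proof (rule hermite_semigroup_cong)
    fix \<nu>
    have "norm (hermite_coeff f \<nu> - hermite_coeff g \<nu>) \<le> 0"
      using dual_bound[OF coeff carr_diff[OF fg(1,2)], of \<nu>] fg(3)
      by (simp add: same_vector_def dual_diff[OF coeff fg(1,2)])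
    then show "hermite_coeff f \<nu> = hermite_coeff g \<nu>" by simp
  qed
  have add: "hermite_semigroup t (\<lambda>x. f x + g x) = (\<lambda>x. hermite_semigroup t f x + hermite_semigroup t g x)"
    if fg: "f \<in> carr (Lp lborel p)" "g \<in> carr (Lp lborel p)" for f g :: "real ^ 'n \<Rightarrow> complex"
  proof
    fix x
    have "hermite_term t (\<lambda>x. f x + g x) i x = hermite_term t f i x + hermite_term t g i x" for i
      by (simp add: hermite_term_def dual_add[OF coeff fg] algebra_simps)
    then show "hermite_semigroup t (\<lambda>x. f x + g x) x = hermite_semigroup t f x + hermite_semigroup t g x"
      using sums_unique2[OF hermite_term_sums[OF t p carr_add[OF fg]], of x]
        sums_add[OF hermite_term_sums[OF t p fg(1)] hermite_term_sums[OF t p fg(2)], of x x] by simp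
  qed
  have scale: "hermite_semigroup t (\<lambda>x. c * f x) = (\<lambda>x. c * hermite_semigroup t f x)"
    if f: "f \<in> carr (Lp lborel p)" for f :: "real ^ 'n \<Rightarrow> complex" and c
  proof
    fix x
    have "hermite_term t (\<lambda>x. c * f x) i x = c * hermite_term t f i x" for i
      by (simp add: hermite_term_def dual_scale[OF coeff f] algebra_simps)
    then show "hermite_semigroup t (\<lambda>x. c * f x) x = c * hermite_semigroup t f x"
      using sums_unique2[OF hermite_term_sums[OF t p carr_scale[OF f]], of c x]
        sums_mult[OF hermite_term_sums[OF t p f], of c x] by simp
  qed
  show ?thesis
    unfolding linear_operator_def
  proof (intro conjI ballI allI impI)
    fix f g :: "real ^ 'n \<Rightarrow> complex" and c
    assume f: "f \<in> carr (Lp lborel p)"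
    show "hermite_semigroup t f \<in> carr (Lp lborel p)"
      by (rule hermite_semigroup_Lp[OF t p f])
    show "same_vector (Lp lborel p) (hermite_semigroup t (\<lambda>x. c * f x)) (\<lambda>x. c * hermite_semigroup t f x)"
      unfolding scale[OF f] by (rule same)
    assume g: "g \<in> carr (Lp lborel p)"
    show "same_vector (Lp lborel p) (hermite_semigroup t (\<lambda>x. f x + g x)) (\<lambda>x. hermite_semigroup t f x + hermite_semigroup t g x)"
      unfolding add[OF f g] by (rule same)
    assume "same_vector (Lp lborel p) f g"
    from cong[OF f g this] show "same_vector (Lp lborel p) (hermite_semigroup t f) (hermite_semigroup t g)"
      by (simp only: same)
  qed
qed

lemma nuclear_rep_hermite_semigroup:
  assumes t: "t > 0" and r: "0 < r" and p: "1 \<le> p"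
  shows "nuclear_rep r (Lp lborel p) (Lp lborel p)
    (hermite_semigroup t :: (real ^ 'n::finite \<Rightarrow> complex) \<Rightarrow> _)
    (\<lambda>i f. of_real (hermite_eigenvalue t (multiindex i :: 'n \<Rightarrow> nat)) * hermite_coeff f (multiindex i))
    (\<lambda>i x. of_real (hermite_fun (multiindex i) x))" (is "nuclear_rep r ?E ?E _ ?e ?y")
  unfolding nuclear_rep_def
proof (intro conjI allI ballI)
  interpret seminormed_fun_space ?E by (rule seminormed_Lp[OF p])
  show e: "?e i \<in> dual ?E" for i
    by (rule hermite_coeff_dual(1)[OF p])
  show y: "?y i \<in> carr ?E" for i
    by (rule hermite_fun_Lp(1)[OF p])
  fix f :: "real ^ 'n \<Rightarrow> complex" assume f: "f \<in> carr ?E"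
  show "(\<lambda>N. nrm ?E (\<lambda>x. hermite_semigroup t f x - (\<Sum>i<N. ?e i f * ?y i x))) \<longlonglongrightarrow> 0"
    using nrm_hermite_remainder_tendsto[OF t p f] unfolding hermite_term_def .
next
  interpret seminormed_fun_space ?E by (rule seminormed_Lp[OF p])
  have e: "?e i \<in> dual ?E" for i
    by (rule hermite_coeff_dual(1)[OF p])
  define m where "m \<nu> = (hermite_eigenvalue t \<nu> * (hermite_bound \<nu>)\<^sup>2 * (weight_mass TYPE('n))\<^sup>2) powr r" for \<nu> :: "'n \<Rightarrow> nat"
  have "m summable_on UNIV"
    unfolding m_def by (rule summable_on_hermite_terms[OF t r]) simp
  then have sm: "summable (\<lambda>i. m (multiindex i))"
    using has_sum_multiindex_sums[OF has_sum_infsum] by (auto simp: sums_iff)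
  show "summable (\<lambda>i. dual_norm ?E (?e i) powr r * nrm ?E (?y i) powr r)"
  proof (rule summable_comparison_test'[OF sm])
    fix i
    let ?\<nu> = "multiindex i :: 'n \<Rightarrow> nat"
    have "dual_norm ?E (?e i) \<le> hermite_eigenvalue t ?\<nu> * (hermite_bound ?\<nu> * weight_mass TYPE('n))"
      using hermite_coeff_dual(2)[OF p, of "of_real (hermite_eigenvalue t ?\<nu>)" ?\<nu>] hermite_eigenvalue_pos[of t ?\<nu>] by simp
    then have "dual_norm ?E (?e i) * nrm ?E (?y i) \<le>
        (hermite_eigenvalue t ?\<nu> * (hermite_bound ?\<nu> * weight_mass TYPE('n))) * (hermite_bound ?\<nu> * weight_mass TYPE('n))"
      using hermite_fun_Lp(2)[OF p, of ?\<nu>] dual_norm_nonneg[OF e] hermite_bound_nonneg[of ?\<nu>]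
        hermite_eigenvalue_pos[of t ?\<nu>] weight_mass_ge_1[where ?'n = 'n]
      by (intro mult_mono) (auto simp: nrm_Lp_nonneg)
    then have "(dual_norm ?E (?e i) * nrm ?E (?y i)) powr r \<le> m ?\<nu>"
      unfolding m_def using r dual_norm_nonneg[OF e]
      by (intro powr_mono2) (auto simp: power2_eq_square mult_ac nrm_Lp_nonneg)
    then show "norm (dual_norm ?E (?e i) powr r * nrm ?E (?y i) powr r) \<le> m ?\<nu>"
      using dual_norm_nonneg[OF e] by (simp add: powr_mult nrm_Lp_nonneg)
  qed
qed

theorem mainTheorem7:
  fixes t r p :: real
  assumes "t > 0" and "0 < r" and "r \<le> 1" and "1 \<le> p"
  shows "\<exists>T :: (real ^ 'n::finite \<Rightarrow> complex) \<Rightarrow> (real ^ 'n \<Rightarrow> complex).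
    r_nuclear r (Lp lborel p) (Lp lborel p) T \<and>
    (\<forall>f \<in> carr (Lp lborel 2) \<inter> carr (Lp lborel p).
       AE x in lborel. T f x = hermite_semigroup t f x) \<and>
    nuclear_trace (Lp lborel p) T =
      of_real (\<Sum>\<^sub>\<infinity>\<nu>::'n \<Rightarrow> nat. exp (- t * (2 * real (mi_abs \<nu>) + real CARD('n)))) \<and>
    (\<Sum>\<^sub>\<infinity>\<nu>::'n \<Rightarrow> nat. exp (- t * (2 * real (mi_abs \<nu>) + real CARD('n)))) =
      (exp t - exp (- t)) powi (- int CARD('n))"
proof (rule exI[of _ "hermite_semigroup t"], intro conjI ballI)
  let ?E = "Lp lborel p :: (real ^ 'n) fun_space"
  let ?T = "hermite_semigroup t :: (real ^ 'n \<Rightarrow> complex) \<Rightarrow> (real ^ 'n \<Rightarrow> complex)"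
  interpret seminormed_fun_space ?E by (rule seminormed_Lp[OF assms(4)])
  note lin = linear_operator_hermite_semigroup[OF assms(1,4), where ?'n = 'n]
  note rep = nuclear_rep_hermite_semigroup[OF assms(1,2,4), where ?'n = 'n]
  note sum = hermite_eigenvalue_has_sum[OF assms(1), where ?'n = 'n]
  show "r_nuclear r ?E ?E ?T"
    unfolding r_nuclear_def using lin rep by blast
  \<comment> \<open>The witness is the formula itself, which already converges on the whole of
    \<open>Lp lborel p\<close>, so agreement on the intersection with \<open>Lp lborel 2\<close> is
    reflexivity.\<close>
  show "AE x in lborel. ?T f x = hermite_semigroup t f x" for f
    by simp
  have eq: "(\<Sum>\<^sub>\<infinity>\<nu>::'n \<Rightarrow> nat. exp (- t * (2 * real (mi_abs \<nu>) + real CARD('n)))) = infsum (hermite_eigenvalue t) (UNIV :: ('n \<Rightarrow> nat) set)"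
    by (intro infsum_cong) (simp add: hermite_eigenvalue_def)
  show "(\<Sum>\<^sub>\<infinity>\<nu>::'n \<Rightarrow> nat. exp (- t * (2 * real (mi_abs \<nu>) + real CARD('n)))) = (exp t - exp (- t)) powi (- int CARD('n))"
    unfolding eq by (rule infsumI[OF sum])
  have "(\<lambda>i. of_real (hermite_eigenvalue t (multiindex i :: 'n \<Rightarrow> nat)) :: complex) sums
      of_real (infsum (hermite_eigenvalue t) (UNIV :: ('n \<Rightarrow> nat) set))"
    unfolding infsumI[OF sum] by (rule sums_of_real[OF has_sum_multiindex_sums[OF sum]])
  then have tr: "(\<lambda>i. of_real (hermite_eigenvalue t (multiindex i :: 'n \<Rightarrow> nat)) *
      hermite_coeff (\<lambda>x :: real ^ 'n. of_real (hermite_fun (multiindex i) x)) (multiindex i)) sums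
      of_real (infsum (hermite_eigenvalue t) (UNIV :: ('n \<Rightarrow> nat) set))"
    by (simp add: hermite_coeff_self)
  show "nuclear_trace ?E ?T = of_real (\<Sum>\<^sub>\<infinity>\<nu>::'n \<Rightarrow> nat. exp (- t * (2 * real (mi_abs \<nu>) + real CARD('n))))"
    unfolding eq
    by (rule nuclear_trace_eqI[OF metric_approximation_property_Lp[OF assms(4)] lin assms(2,3) rep tr])
qed

end
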